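(* Let $1<p<m$. For any $\sigma>0$, there exists at least one good profile with interface $f$ to the equation $$(f^m)''(\xi)-\alpha f(\xi)+\beta\xi f'(\xi)+\xi^{\sigma}f(\xi)^p=0,\qquad \xi\in[0,\infty),$$ where $\alpha=\frac{\sigma+2}{2(p-1)+\sigma(m-1)}$ and $\beta=\frac{m-p}{2(p-1)+\sigma(m-1)}$.
   Context: Solutions $f$ of the differential equation are nonnegative: $f:[0,\infty)\to[0,\infty)$ is continuous, $f^m$ is $C^1$, and the equation holds classically at every $\xi>0$ with $f(\xi)>0$. A solution $f$ is a \emph{good profile} if it fulfills one of the following two properties at $\xi=0$: (P1) $f(0)=a>0$ and $f'(0)=0$; (P2) $f(0)=0$ and $(f^m)'(0)=0$. A good profile $f$ is a \emph{good profile with interface} at a point $\eta\in(0,\infty)$ if $f(\eta)=0$, $(f^m)'(\eta)=0$ and $f>0$ on $(\eta-\delta,\eta)$ for some $\delta>0$. *)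

theory Defs
  imports "HOL-Analysis.Analysis"
begin

definition profile_alpha :: "real \<Rightarrow> real \<Rightarrow> real \<Rightarrow> real" where
  "profile_alpha m p \<sigma> = (\<sigma> + 2) / (2 * (p - 1) + \<sigma> * (m - 1))"

definition profile_beta :: "real \<Rightarrow> real \<Rightarrow> real \<Rightarrow> real" where
  "profile_beta m p \<sigma> = (m - p) / (2 * (p - 1) + \<sigma> * (m - 1))"

(* C1 on the closed half-line, with the one-sided derivative at 0. The library predicate
   C1_differentiable_on asks for two-sided derivatives also at end points. *)
definition C1_halfline :: "(real \<Rightarrow> real) \<Rightarrow> bool" where
  "C1_halfline u \<longleftrightarrow>
    (\<exists>u'. continuous_on {0..} u' \<and>
      (\<forall>x\<ge>0. (u has_real_derivative u' x) (at x within {0..})))"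

(* Functions on [0,oo) are represented by functions on the reals whose values at negative
   arguments are irrelevant. The differentiability clauses are needed because deriv is total.
   Continuity of the second derivative of f^m on the positivity set need not be demanded:
   f and f' are continuous there since f^m is C1, so it follows from the equation. *)
definition profile_solution :: "real \<Rightarrow> real \<Rightarrow> real \<Rightarrow> (real \<Rightarrow> real) \<Rightarrow> bool" where
  "profile_solution m p \<sigma> f \<longleftrightarrow>
    (\<forall>\<xi>\<ge>0. f \<xi> \<ge> 0) \<and>
    continuous_on {0..} f \<and>
    C1_halfline (\<lambda>x. f x powr m) \<and>
    (\<forall>\<xi>>0. f \<xi> > 0 \<longrightarrow>
      f differentiable (at \<xi>) \<and>
      deriv (\<lambda>x. f x powr m) differentiable (at \<xi>) \<and>
      deriv (deriv (\<lambda>x. f x powr m)) \<xi> - profile_alpha m p \<sigma> * f \<xi>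
        + profile_beta m p \<sigma> * \<xi> * deriv f \<xi> + \<xi> powr \<sigma> * f \<xi> powr p = 0)"

definition good_profile :: "real \<Rightarrow> real \<Rightarrow> real \<Rightarrow> (real \<Rightarrow> real) \<Rightarrow> bool" where
  "good_profile m p \<sigma> f \<longleftrightarrow>
    profile_solution m p \<sigma> f \<and>
    ((f 0 > 0 \<and> (f has_real_derivative 0) (at 0 within {0..})) \<or>
     (f 0 = 0 \<and> ((\<lambda>x. f x powr m) has_real_derivative 0) (at 0 within {0..})))"

(* The interval (eta - delta, eta) is to lie in the domain [0,oo), hence the bound on delta;
   shrinking delta shows that this is no restriction. *)
definition good_profile_interface_at ::
    "real \<Rightarrow> real \<Rightarrow> real \<Rightarrow> (real \<Rightarrow> real) \<Rightarrow> real \<Rightarrow> bool" where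
  "good_profile_interface_at m p \<sigma> f \<eta> \<longleftrightarrow>
    good_profile m p \<sigma> f \<and> \<eta> > 0 \<and> f \<eta> = 0 \<and>
    ((\<lambda>x. f x powr m) has_real_derivative 0) (at \<eta>) \<and>
    (\<exists>\<delta>>0. \<delta> \<le> \<eta> \<and> (\<forall>x\<in>{\<eta> - \<delta><..<\<eta>}. f x > 0))"

end

theory Submission
  imports Defs "HOL-Complex_Analysis.Great_Picard" "HOL-Real_Asymp.Real_Asymp"
begin

text \<open>
  Put the interface at \<open>\<xi> = \<eta>\<close>, run backwards in \<open>t = 1 - \<xi> / \<eta>\<close> and let \<open>W\<close> be the suitably
  rescaled \<open>f\<^sup>m\<close>, so that \<open>\<phi> = W\<^bsup>1/m\<^esup>\<close> is the rescaled \<open>f\<close>. As the profile and the derivative of its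
  \<open>m\<close>-th power vanish at the interface, integrating the equation once from there gives
  \<open>W' = B (1 - t) \<phi> + U\<close>, \<open>U' = a \<phi> - \<lambda> (1 - t)\<^sup>\<sigma> \<phi>\<^sup>p\<close>, \<open>W 0 = U 0 = 0\<close>, where \<open>B = \<beta>\<close> and
  \<open>a = \<alpha> + \<beta>\<close>. The position of the interface has become the positive parameter \<open>\<lambda>\<close>.
  It suffices to find a value of \<open>\<lambda>\<close> and a nonnegative trajectory, positive right after \<open>t = 0\<close>,
  with \<open>W' = 0\<close> at \<open>t = 1\<close>, or with \<open>W = W' = 0\<close> at an earlier time, after which \<open>W\<close> is continued
  by zero: the equation is only demanded where \<open>f\<close> is positive.

  The parameter is found by shooting. For \<open>\<lambda> = 0\<close> nothing opposes growth, so \<open>W\<close> increases and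
  \<open>W' 1 > 0\<close>. For large \<open>\<lambda>\<close> the reaction forces \<open>W\<close> down to zero before \<open>t = 1\<close>
  (\<open>no_positive_orbit\<close>). At the first value of \<open>\<lambda>\<close> at which \<open>W\<close> touches a prescribed low level
  or \<open>W' 1 > 0\<close> fails, either \<open>W' 1 = 0\<close>, or the level is touched with slope zero.

  At \<open>W = 0\<close> the system is degenerate: \<open>\<phi>\<close> is not Lipschitz in \<open>W\<close>, and the zero function is a
  second solution. Shooting is therefore done from the height \<open>W 0 = 2 \<epsilon>\<close> with the powers of \<open>W\<close>
  cut off below \<open>\<epsilon>\<close>, which gives a globally Lipschitz problem depending continuously on \<open>\<lambda>\<close>
  (\<open>picard_lindelof_parameter\<close>). The critical trajectory satisfies \<open>W \<ge> \<epsilon>\<close>, hence never sees the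
  cutoff (\<open>shooting\<close>). The bounds of \<open>orbit_bounded\<close> and the Arzela-Ascoli theorem
  (\<open>ode_solutions_compact\<close>) allow \<open>\<epsilon>\<close> to tend to zero, and the lower bound of \<open>orbit_start\<close>,
  \<open>W\<^bsup>1-1/m\<^esup> \<ge> b t\<close> near \<open>t = 0\<close> uniformly in \<open>\<epsilon>\<close>, keeps the limit from being zero (\<open>limit_orbit\<close>).
\<close>

section \<open>Differential equations depending on a parameter\<close>

text \<open>
  Rescaling the integral to \<open>t \<integral>\<^sub>0\<^sup>1 g l (t s) ds\<close> moves \<open>t\<close> from the domain of integration into the
  integrand, where it is one more parameter.
\<close>

lemma continuous_on_indefinite_integral_param:
  fixes g :: "'l::topological_space \<Rightarrow> real \<Rightarrow> 'a::banach"
  assumes g: "continuous_on (A \<times> {0..1}) (\<lambda>(l,t). g l t)"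
  shows "continuous_on (A \<times> {0..1}) (\<lambda>(l,t). integral {0..t} (g l))"
proof -
  have gl: "continuous_on {0..1} (g l)" if "l \<in> A" for l
    using continuous_on_compose2[OF g, of "{0..1}" "\<lambda>t. (l,t)"] that
    by (force intro: continuous_on_Pair continuous_on_const continuous_on_id)
  have stretch: "integral {0..t} (g l) = t *\<^sub>R integral {0..1} (\<lambda>s. g l (t * s))"
    if l: "l \<in> A" and t: "t \<in> {0..1}" for l t
  proof -
    have ts: "t * s \<in> {0..1}" if "s \<in> {0..1}" for s
      using that t by (auto intro: mult_le_one)
    have "((\<lambda>s. integral {0..t * s} (g l)) has_vector_derivative t *\<^sub>R g l (t * s))
            (at s within {0..1})" if s: "s \<in> {0..1}" for s
    proof -
      have "((\<lambda>u. integral {0..u} (g l)) has_vector_derivative g l (t * s))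
              (at (t * s) within {0..1})"
        by (rule integral_has_vector_derivative[OF gl[OF l] ts[OF s]])
      then have "((\<lambda>u. integral {0..u} (g l)) has_vector_derivative g l (t * s))
              (at (t * s) within (*) t ` {0..1})"
        by (rule has_vector_derivative_within_subset) (use ts in auto)
      moreover have "((*) t has_vector_derivative t) (at s within {0..1})"
        by (auto intro!: derivative_eq_intros)
      ultimately show ?thesis
        using vector_diff_chain_within[of "(*) t" t s "{0..1}"] by (auto simp: o_def)
    qed
    then have "((\<lambda>s. t *\<^sub>R g l (t * s)) has_integral
        integral {0..t * 1} (g l) - integral {0..t * 0} (g l)) {0..1}"
      by (intro fundamental_theorem_of_calculus) auto
    then have "((\<lambda>s. t *\<^sub>R g l (t * s)) has_integral integral {0..t} (g l)) {0..1}"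
      by simp
    then have "integral {0..1} (\<lambda>s. t *\<^sub>R g l (t * s)) = integral {0..t} (g l)"
      by (rule integral_unique)
    then show ?thesis by simp
  qed
  have "continuous_on ((A \<times> {0..1}) \<times> cbox 0 1) (\<lambda>(z, s). g (fst z) (snd z * s))"
    unfolding split_beta
    by (rule continuous_on_compose2[OF g[unfolded split_beta], of _ "\<lambda>w. (fst (fst w), snd (fst w) * snd w)", simplified])
       (auto intro!: continuous_intros mult_le_one)
  from integral_continuous_on_param[OF this]
  have "continuous_on (A \<times> {0..1}) (\<lambda>z. snd z *\<^sub>R integral {0..1} (\<lambda>s. g (fst z) (snd z * s)))"
    by (auto intro!: continuous_intros simp: split_beta)
  then show ?thesis
    by (rule continuous_on_eq) (auto simp: stretch)
qed

text \<open>
  The Picard iterates are jointly continuous in parameter and time. Measured against the weight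
  \<open>exp (2 L t)\<close>, successive differences shrink by the factor \<open>1/2\<close>, so the iterates converge
  uniformly on the whole product \<open>A \<times> {0..1}\<close> and the limit is again jointly continuous.
\<close>

theorem picard_lindelof_parameter:
  fixes F :: "'l::topological_space \<Rightarrow> real \<Rightarrow> 'a::banach \<Rightarrow> 'a"
  assumes A: "compact A"
    and contF: "continuous_on (A \<times> {0..1} \<times> UNIV) (\<lambda>(l,t,x). F l t x)"
    and lip: "\<And>l t x y. l \<in> A \<Longrightarrow> t \<in> {0..1} \<Longrightarrow> norm (F l t x - F l t y) \<le> L * norm (x - y)"
    and L: "L > 0"
  obtains x where "continuous_on (A \<times> {0..1}) (\<lambda>(l,t). x l t)"
    and "\<And>l. l \<in> A \<Longrightarrow> x l 0 = x0"
    and "\<And>l t. l \<in> A \<Longrightarrow> t \<in> {0..1} \<Longrightarrow>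
           (x l has_vector_derivative F l t (x l t)) (at t within {0..1})"
proof -
  define P where "P = rec_nat (\<lambda>l t. x0) (\<lambda>n p l t. x0 + integral {0..t} (\<lambda>s. F l s (p l s)))"
  have P0: "P 0 l t = x0" for l t by (simp add: P_def)
  have PS: "P (Suc n) l t = x0 + integral {0..t} (\<lambda>s. F l s (P n l s))" for n l t
    by (simp add: P_def)
  have contFp: "continuous_on (A \<times> {0..1}) (\<lambda>(l,t). F l t (p l t))"
    if "continuous_on (A \<times> {0..1}) (\<lambda>(l,t). p l t)" for p
  proof -
    have "continuous_on (A \<times> {0..1}) (\<lambda>z. (fst z, snd z, p (fst z) (snd z)))"
      using that by (auto intro!: continuous_intros simp: split_beta)
    then have "continuous_on (A \<times> {0..1})
        (\<lambda>z. (\<lambda>(l,t,x). F l t x) (fst z, snd z, p (fst z) (snd z)))"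
      by (rule continuous_on_compose2[OF contF]) auto
    then show ?thesis by (simp add: split_beta)
  qed
  have contP: "continuous_on (A \<times> {0..1}) (\<lambda>(l,t). P n l t)" for n
  proof (induction n)
    case 0
    then show ?case by (simp add: P0)
  next
    case (Suc n)
    have "continuous_on (A \<times> {0..1}) (\<lambda>z. x0 + (\<lambda>(l,t). integral {0..t} (\<lambda>s. F l s (P n l s))) z)"
      by (intro continuous_intros continuous_on_indefinite_integral_param contFp Suc)
    then show ?case by (simp add: PS split_beta)
  qed
  have slice: "continuous_on {0..t} (\<lambda>s. F l s (p l s))"
    if "continuous_on (A \<times> {0..1}) (\<lambda>(l,t). p l t)" "l \<in> A" "t \<in> {0..1}" for p l t
    using continuous_on_compose2[OF contFp[OF that(1)], of "{0..t}" "\<lambda>t. (l,t)"] that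
    by (force intro: continuous_on_Pair continuous_on_const continuous_on_id)
  obtain M where M: "\<And>l t. l \<in> A \<Longrightarrow> t \<in> {0..1} \<Longrightarrow> norm (F l t x0) \<le> M"
  proof -
    have "compact ((\<lambda>(l,t). F l t x0) ` (A \<times> {0..1}))"
      using contP[of 0] by (intro compact_continuous_image contFp compact_Times A) (auto simp: P0)
    then obtain M where "\<And>v. v \<in> (\<lambda>(l,t). F l t x0) ` (A \<times> {0..1}) \<Longrightarrow> norm v \<le> M"
      using compact_imp_bounded bounded_iff by metis
    then show ?thesis by (intro that[of M]) force
  qed
  have diff: "norm (P (Suc n) l t - P n l t) \<le> M * (1/2)^n * exp (2 * L * t)"
    if "l \<in> A" "t \<in> {0..1}" for n l t
    using that
  proof (induction n arbitrary: t)
    case 0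
    have "0 \<le> M" using M[OF 0] norm_ge_zero order_trans by blast
    have "norm (integral {0..t} (\<lambda>s. F l s x0)) \<le> M * (t - 0)"
      using slice[OF contP[of 0] 0] M 0 by (intro integral_bound) (auto simp: P0)
    also have "\<dots> \<le> M * exp (2 * L * t)"
      using \<open>0 \<le> M\<close> 0 L exp_ge_add_one_self[of "2*L*t"] by (intro mult_left_mono) (auto intro: order_trans[of _ 1])
    finally show ?case by (simp add: PS P0)
  next
    case (Suc n)
    have "0 \<le> M" using M[OF Suc(2,3)] norm_ge_zero order_trans by blast
    have I: "((\<lambda>s. M * (1/2)^n * L * exp (2 * L * s)) has_integral
        M * (1/2)^(Suc n) * exp (2 * L * t) - M * (1/2)^(Suc n) * exp (2 * L * 0)) {0..t}"
      using Suc.prems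
      by (intro fundamental_theorem_of_calculus)
         (auto intro!: derivative_eq_intros simp flip: has_real_derivative_iff_has_vector_derivative)
    have "P (Suc (Suc n)) l t - P (Suc n) l t =
        integral {0..t} (\<lambda>s. F l s (P (Suc n) l s) - F l s (P n l s))"
      unfolding PS[of "Suc n" l t] PS[of n l t]
      using Suc.prems slice[OF contP, of l t]
      by (subst integral_diff) (auto intro: integrable_continuous_real)
    also have "norm \<dots> \<le> integral {0..t} (\<lambda>s. M * (1/2)^n * L * exp (2 * L * s))"
    proof (rule integral_norm_bound_integral)
      show "(\<lambda>s. F l s (P (Suc n) l s) - F l s (P n l s)) integrable_on {0..t}"
        using Suc.prems slice[OF contP] by (intro integrable_continuous_real continuous_intros) auto
      show "(\<lambda>s. M * (1/2)^n * L * exp (2 * L * s)) integrable_on {0..t}"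
        using I by blast
      fix s assume s: "s \<in> {0..t}"
      then have s1: "s \<in> {0..1}" using Suc.prems by auto
      have "norm (F l s (P (Suc n) l s) - F l s (P n l s)) \<le> L * norm (P (Suc n) l s - P n l s)"
        by (rule lip) (use Suc.prems s1 in auto)
      also have "\<dots> \<le> L * (M * (1/2)^n * exp (2 * L * s))"
        using Suc.IH[OF Suc.prems(1) s1] L by (intro mult_left_mono) auto
      finally show "norm (F l s (P (Suc n) l s) - F l s (P n l s)) \<le> M * (1/2)^n * L * exp (2 * L * s)"
        by (simp add: mult_ac)
    qed
    also have "\<dots> \<le> M * (1/2)^(Suc n) * exp (2 * L * t)"
      using integral_unique[OF I] \<open>0 \<le> M\<close> by simp
    finally show ?case .
  qed
  have "uniform_limit (A \<times> {0..1}) (\<lambda>n z. \<Sum>i<n. P (Suc i) (fst z) (snd z) - P i (fst z) (snd z))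
      (\<lambda>z. \<Sum>i. P (Suc i) (fst z) (snd z) - P i (fst z) (snd z)) sequentially"
  proof (rule Weierstrass_m_test)
    fix n :: nat and z :: "'l \<times> real" assume z: "z \<in> A \<times> {0..1}"
    have "0 \<le> M" using z M norm_ge_zero order_trans by (metis mem_Times_iff)
    have "norm (P (Suc n) (fst z) (snd z) - P n (fst z) (snd z)) \<le> M * (1/2)^n * exp (2 * L * snd z)"
      using z by (intro diff) auto
    also have "\<dots> \<le> M * (1/2)^n * exp (2 * L)"
      using z L \<open>0 \<le> M\<close> by (intro mult_left_mono) auto
    finally show "norm (P (Suc n) (fst z) (snd z) - P n (fst z) (snd z)) \<le> M * exp (2 * L) * (1/2)^n"
      by (simp add: mult_ac)
  next
    show "summable (\<lambda>n. M * exp (2 * L) * (1/2)^n)"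
      by (intro summable_mult summable_geometric) auto
  qed
  moreover have telescope: "(\<Sum>i<n. P (Suc i) l t - P i l t) = P n l t - x0" for n l t
    using sum_lessThan_telescope[of "\<lambda>i. P i l t" n] by (simp add: P0)
  ultimately have "uniform_limit (A \<times> {0..1}) (\<lambda>n z. P n (fst z) (snd z) - x0)
      (\<lambda>z. \<Sum>i. P (Suc i) (fst z) (snd z) - P i (fst z) (snd z)) sequentially"
    by (simp only: telescope)
  then have "uniform_limit (A \<times> {0..1}) (\<lambda>n z. x0 + (P n (fst z) (snd z) - x0))
      (\<lambda>z. x0 + (\<Sum>i. P (Suc i) (fst z) (snd z) - P i (fst z) (snd z))) sequentially"
    by (intro uniform_limit_intros)
  then have "\<exists>X. uniform_limit (A \<times> {0..1}) (\<lambda>n z. P n (fst z) (snd z)) X sequentially"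
    by auto
  then obtain X where X: "uniform_limit (A \<times> {0..1}) (\<lambda>n z. P n (fst z) (snd z)) X sequentially"
    by blast
  define x where "x l t = X (l, t)" for l t
  have ul: "uniform_limit (A \<times> {0..1}) (\<lambda>n z. P n (fst z) (snd z)) (\<lambda>(l,t). x l t) sequentially"
    using X by (simp add: x_def)
  have contx: "continuous_on (A \<times> {0..1}) (\<lambda>(l,t). x l t)"
    by (rule uniform_limit_theorem[OF _ ul]) (use contP in \<open>auto simp: split_beta\<close>)
  have eq: "x l t = x0 + integral {0..t} (\<lambda>s. F l s (x l s))" if l: "l \<in> A" and t: "t \<in> {0..1}" for l t
  proof -
    have "uniform_limit {0..t} (\<lambda>n s. F l s (P n l s)) (\<lambda>s. F l s (x l s)) sequentially"
    proof (rule uniform_limitI)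
      fix e :: real assume e: "e > 0"
      from uniform_limitD[OF ul, of "e / L"] e L
      have "\<forall>\<^sub>F n in sequentially. \<forall>z\<in>A \<times> {0..1}. dist (P n (fst z) (snd z)) (x (fst z) (snd z)) < e / L"
        by (simp add: split_beta)
      then show "\<forall>\<^sub>F n in sequentially. \<forall>s\<in>{0..t}. dist (F l s (P n l s)) (F l s (x l s)) < e"
      proof eventually_elim
        case (elim n)
        show ?case
        proof
          fix s assume s: "s \<in> {0..t}"
          have "dist (P n l s) (x l s) < e / L" using elim l t s by force
          then have "L * norm (P n l s - x l s) < e" using L by (simp add: dist_norm field_simps)
          moreover have "norm (F l s (P n l s) - F l s (x l s)) \<le> L * norm (P n l s - x l s)"
            using s t by (intro lip l) auto
          ultimately show "dist (F l s (P n l s)) (F l s (x l s)) < e" by (simp add: dist_norm)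
        qed
      qed
    qed
    then obtain I J where I: "\<And>n. ((\<lambda>s. F l s (P n l s)) has_integral I n) {0..t}"
      and J: "((\<lambda>s. F l s (x l s)) has_integral J) {0..t}" and IJ: "I \<longlonglongrightarrow> J"
      by (rule uniform_limit_integral) (use slice[OF contP l t] in auto)
    have "(\<lambda>n. P (Suc n) l t) \<longlonglongrightarrow> x0 + J"
      using IJ by (auto simp: PS integral_unique[OF I] intro!: tendsto_intros)
    moreover have "(\<lambda>n. P (Suc n) l t) \<longlonglongrightarrow> x l t"
      using tendsto_uniform_limitI[OF ul, of "(l,t)"] l t by (auto intro: LIMSEQ_Suc)
    ultimately have "x l t = x0 + J" by (metis LIMSEQ_unique)
    then show ?thesis using J by (simp add: integral_unique)
  qed
  show ?thesis
  proof (rule that[OF contx])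
    show "x l 0 = x0" if "l \<in> A" for l using eq[OF that, of 0] by simp
    fix l t assume l: "l \<in> A" and t: "t \<in> {0..1::real}"
    have "((\<lambda>t. x0 + integral {0..t} (\<lambda>s. F l s (x l s))) has_vector_derivative 0 + F l t (x l t)) (at t within {0..1})"
      using slice[OF contx l, of 1] t
      by (intro has_vector_derivative_add has_vector_derivative_const integral_has_vector_derivative) auto
    then show "(x l has_vector_derivative F l t (x l t)) (at t within {0..1})"
      using eq[OF l] t by (auto intro: has_vector_derivative_transform)
  qed
qed

text \<open>
  On a compact set of states the right-hand side is bounded, so the solutions are equi-Lipschitz and
  Arzela-Ascoli applies. Uniform convergence passes to the derivatives because the right-hand side is
  uniformly continuous there.
\<close>

theorem ode_solutions_compact:
  fixes F :: "'l::metric_space \<Rightarrow> real \<Rightarrow> 'a::euclidean_space \<Rightarrow> 'a"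
  assumes A: "compact A" and K: "compact K"
    and contF: "continuous_on (A \<times> {0..1} \<times> K) (\<lambda>(l,t,x). F l t x)"
    and l: "\<And>n. l n \<in> A" and x: "\<And>n t. t \<in> {0..1} \<Longrightarrow> x n t \<in> K"
    and der: "\<And>n t. t \<in> {0..1} \<Longrightarrow>
           (x n has_vector_derivative F (l n) t (x n t)) (at t within {0..1})"
  obtains r l' y where "strict_mono (r :: nat \<Rightarrow> nat)" "l' \<in> A" "(\<lambda>n. l (r n)) \<longlonglongrightarrow> l'"
    and "uniform_limit {0..1} (\<lambda>n. x (r n)) y sequentially"
    and "\<And>t. t \<in> {0..1} \<Longrightarrow> y t \<in> K"
    and "\<And>t. t \<in> {0..1} \<Longrightarrow> (y has_vector_derivative F l' t (y t)) (at t within {0..1})"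
proof -
  have compF: "compact ((\<lambda>(l,t,x). F l t x) ` (A \<times> {0..1} \<times> K))"
    by (intro compact_continuous_image contF compact_Times A K compact_Icc)
  then obtain C where C0: "C > 0" and "\<And>v. v \<in> (\<lambda>(l,t,x). F l t x) ` (A \<times> {0..1} \<times> K) \<Longrightarrow> norm v \<le> C"
    using compact_imp_bounded bounded_pos by metis
  then have C: "norm (F k t z) \<le> C" if "k \<in> A" "t \<in> {0..1}" "z \<in> K" for k t z
    using that by force
  have lips: "norm (x n s - x n t) \<le> C * norm (s - t)" if "s \<in> {0..1}" "t \<in> {0..1}" for n s t
  proof (rule differentiable_bound[of "{0..1}" "x n" "\<lambda>t h. h *\<^sub>R F (l n) t (x n t)"])
    show "(x n has_derivative (\<lambda>h. h *\<^sub>R F (l n) u (x n u))) (at u within {0..1})" if "u \<in> {0..1}" for u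
      using der[OF that] by (simp add: has_vector_derivative_def)
    show "onorm (\<lambda>h. h *\<^sub>R F (l n) u (x n u)) \<le> C" if "u \<in> {0..1}" for u
      using C[OF l that x[OF that]]
      by (intro onorm_le) (auto simp: mult.commute[of C] intro: mult_left_mono)
  qed (use that in auto)
  obtain l' r1 where l': "l' \<in> A" and r1: "strict_mono (r1 :: nat \<Rightarrow> nat)" and lim1: "(l \<circ> r1) \<longlonglongrightarrow> l'"
    using A l unfolding compact_def by meson
  obtain M where M: "\<And>z. z \<in> K \<Longrightarrow> norm z \<le> M"
    using K compact_imp_bounded bounded_iff by metis
  obtain y r2 where conty: "continuous_on {0..1} y" and r2: "strict_mono (r2 :: nat \<Rightarrow> nat)"
    and lim2: "\<And>e. 0 < e \<Longrightarrow> \<exists>N. \<forall>n t. n \<ge> N \<and> t \<in> {0..1} \<longrightarrow> norm (x (r1 (r2 n)) t - y t) < e"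
  proof (rule Arzela_Ascoli[of "{0..1::real}" "\<lambda>n. x (r1 n)" M])
    show "norm (x (r1 n) t) \<le> M" if "t \<in> {0..1}" for n t
      using M x that by blast
    fix t e :: real assume t: "t \<in> {0..1}" and e: "0 < e"
    have "norm (x (r1 n) t - x (r1 n) s) < e" if "s \<in> {0..1}" "norm (t - s) < e / C" for n s
    proof -
      have "norm (x (r1 n) t - x (r1 n) s) \<le> C * norm (t - s)" using lips t that by blast
      also have "\<dots> < e" using that C0 by (simp add: field_simps)
      finally show ?thesis .
    qed
    then show "\<exists>d>0. \<forall>n s. s \<in> {0..1} \<and> norm (t - s) < d \<longrightarrow> norm (x (r1 n) t - x (r1 n) s) < e"
      using e C0 by (intro exI[of _ "e / C"]) auto
  qed auto
  define r where "r = r1 \<circ> r2"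
  have r: "strict_mono r" unfolding r_def using r1 r2 by (rule strict_mono_o)
  have limr: "(\<lambda>n. l (r n)) \<longlonglongrightarrow> l'"
    using LIMSEQ_subseq_LIMSEQ[OF lim1 r2] by (simp add: r_def o_def)
  have ul: "uniform_limit {0..1} (\<lambda>n. x (r n)) y sequentially"
    by (rule uniform_limitI) (use lim2 in \<open>force simp: r_def dist_norm eventually_sequentially\<close>)
  have yK: "y t \<in> K" if "t \<in> {0..1}" for t
    using tendsto_uniform_limitI[OF ul that] x[OF that] compact_imp_closed[OF K]
    by (metis closed_sequentially)
  have ulz: "uniform_limit {0..1} (\<lambda>n t. (l (r n), t, x (r n) t)) (\<lambda>t. (l', t, y t)) sequentially"
  proof (rule uniform_limitI)
    fix e :: real assume e: "e > 0"
    have "\<forall>\<^sub>F n in sequentially. dist (l (r n)) l' < e / 2"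
      using limr e by (intro tendstoD) auto
    moreover have "\<forall>\<^sub>F n in sequentially. \<forall>t\<in>{0..1}. dist (x (r n) t) (y t) < e / 2"
      using ul e by (intro uniform_limitD) auto
    ultimately show "\<forall>\<^sub>F n in sequentially. \<forall>t\<in>{0..1}. dist (l (r n), t, x (r n) t) (l', t, y t) < e"
    proof eventually_elim
      case (elim n)
      show ?case
      proof
        fix t :: real assume t: "t \<in> {0..1}"
        have "dist (l (r n), t, x (r n) t) (l', t, y t) \<le> dist (l (r n)) l' + dist (x (r n) t) (y t)"
          by (simp add: dist_Pair_Pair real_sqrt_sum_squares_triangle_ineq sqrt_sum_squares_le_sum)
        also have "\<dots> < e" using elim t by fastforce
        finally show "dist (l (r n), t, x (r n) t) (l', t, y t) < e" .
      qed
    qed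
  qed
  have "uniform_limit {0..1} (\<lambda>n t. (\<lambda>(l,t,x). F l t x) (l (r n), t, x (r n) t))
      (\<lambda>t. (\<lambda>(l,t,x). F l t x) (l', t, y t)) sequentially"
  proof (rule uniform_limit_compose_uniformly_continuous_on[OF ulz])
    show "uniformly_continuous_on (A \<times> {0..1} \<times> K) (\<lambda>(l,t,x). F l t x)"
      by (intro compact_uniformly_continuous contF compact_Times A K compact_Icc)
    show "closed (A \<times> {0..1::real} \<times> K)"
      by (intro closed_Times compact_imp_closed A K) auto
  qed (use l x in auto)
  then have ulF: "uniform_limit {0..1} (\<lambda>n t. F (l (r n)) t (x (r n) t)) (\<lambda>t. F l' t (y t)) sequentially"
    by simp
  have "\<exists>g. \<forall>t\<in>{0..1}. (\<lambda>n. x (r n) t) \<longlonglongrightarrow> g t \<and>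
      (g has_derivative (\<lambda>h. h *\<^sub>R F l' t (y t))) (at t within {0..1})"
  proof (rule has_derivative_sequence[where f' = "\<lambda>n t h. h *\<^sub>R F (l (r n)) t (x (r n) t)"])
    show "(x (r n) has_derivative (\<lambda>h. h *\<^sub>R F (l (r n)) t (x (r n) t))) (at t within {0..1})"
      if "t \<in> {0..1}" for n t
      using der[OF that] by (simp add: has_vector_derivative_def)
    show "\<forall>\<^sub>F n in sequentially. \<forall>t\<in>{0..1}. \<forall>h.
        norm (h *\<^sub>R F (l (r n)) t (x (r n) t) - h *\<^sub>R F l' t (y t)) \<le> e * norm h" if "e > 0" for e
      using uniform_limitD[OF ulF that]
    proof eventually_elim
      case (elim n)
      show ?case
      proof (intro ballI allI)
        fix t h :: real assume t: "t \<in> {0..1}"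
        have "norm (h *\<^sub>R F (l (r n)) t (x (r n) t) - h *\<^sub>R F l' t (y t)) =
            \<bar>h\<bar> * norm (F (l (r n)) t (x (r n) t) - F l' t (y t))"
          by (metis norm_scaleR scaleR_diff_right)
        also have "\<dots> \<le> \<bar>h\<bar> * e" using elim t by (intro mult_left_mono) (auto simp: dist_norm less_imp_le)
        finally show "norm (h *\<^sub>R F (l (r n)) t (x (r n) t) - h *\<^sub>R F l' t (y t)) \<le> e * norm h"
          by (simp add: mult.commute)
      qed
    qed
    show "(\<lambda>n. x (r n) 0) \<longlonglongrightarrow> y 0" using tendsto_uniform_limitI[OF ul] by auto
  qed auto
  then obtain g where g: "\<And>t. t \<in> {0..1} \<Longrightarrow> (\<lambda>n. x (r n) t) \<longlonglongrightarrow> g t"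
    "\<And>t. t \<in> {0..1} \<Longrightarrow> (g has_vector_derivative F l' t (y t)) (at t within {0..1})"
    unfolding has_vector_derivative_def by blast
  have gy: "g t = y t" if "t \<in> {0..1}" for t
    using g(1)[OF that] tendsto_uniform_limitI[OF ul that] by (rule LIMSEQ_unique)
  have "(y has_vector_derivative F l' t (y t)) (at t within {0..1})" if "t \<in> {0..1}" for t
    by (rule has_vector_derivative_transform[OF that _ g(2)[OF that]]) (simp add: gy)
  then show ?thesis using that r l' limr ul yK by blast
qed

section \<open>Monotonicity and barriers on an interval\<close>

lemma mvt_within:
  fixes f :: "real \<Rightarrow> real"
  assumes "s < e" "{s..e} \<subseteq> S"
    and der: "\<And>t. t \<in> {s..e} \<Longrightarrow> (f has_real_derivative f' t) (at t within S)"
  obtains \<xi> where "s < \<xi>" "\<xi> < e" "f e - f s = f' \<xi> * (e - s)"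
proof -
  have "\<exists>\<xi>\<in>{s<..<e}. f e - f s = (\<lambda>h. f' \<xi> * h) (e - s)"
  proof (rule mvt_simple)
    fix t assume "s \<le> t" "t \<le> e"
    then have "t \<in> {s..e}" by simp
    then have "(f has_real_derivative f' t) (at t within {s..e})"
      using der has_field_derivative_subset assms(2) by blast
    then show "(f has_derivative (\<lambda>h. f' t * h)) (at t within {s..e})"
      by (simp add: has_field_derivative_def)
  qed (use assms in auto)
  then show ?thesis using that by auto
qed

lemma growth_ge:
  fixes f :: "real \<Rightarrow> real"
  assumes "s \<le> e" "{s..e} \<subseteq> S"
    and "\<And>t. t \<in> {s..e} \<Longrightarrow> (f has_real_derivative f' t) (at t within S)"
    and "\<And>t. t \<in> {s<..<e} \<Longrightarrow> f' t \<ge> c"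
  shows "f e - f s \<ge> c * (e - s)"
proof (cases "s = e")
  case False
  then have "s < e" using assms by simp
  then obtain \<xi> where "s < \<xi>" "\<xi> < e" "f e - f s = f' \<xi> * (e - s)"
    using mvt_within[OF _ assms(2,3)] by blast
  then show ?thesis using assms(4)[of \<xi>] by (auto intro: mult_right_mono)
qed simp

lemma growth_le:
  fixes f :: "real \<Rightarrow> real"
  assumes "s \<le> e" "{s..e} \<subseteq> S"
    and "\<And>t. t \<in> {s..e} \<Longrightarrow> (f has_real_derivative f' t) (at t within S)"
    and "\<And>t. t \<in> {s<..<e} \<Longrightarrow> f' t \<le> c"
  shows "f e - f s \<le> c * (e - s)"
proof -
  have "- f e - - f s \<ge> - c * (e - s)"
    by (rule growth_ge[OF assms(1,2), of "\<lambda>t. - f t" "\<lambda>t. - f' t"])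
       (auto intro!: DERIV_minus assms(3,4))
  then show ?thesis by simp
qed

lemma compact_level_Icc:
  fixes f :: "real \<Rightarrow> real"
  assumes "continuous_on {s..e} f" "closed C"
  shows "compact ({s..e} \<inter> f -` C)"
proof -
  have "closed ({s..e} \<inter> f -` C)" using assms by (intro continuous_closed_preimage) auto
  then have "compact ({s..e} \<inter> ({s..e} \<inter> f -` C))" by (intro compact_Int_closed) auto
  then show ?thesis by simp
qed

lemma first_zero:
  fixes V :: "real \<Rightarrow> real"
  assumes cont: "continuous_on {0..T} V" and V0: "V 0 > 0" and t0: "t0 \<in> {0..T}" "V t0 \<le> 0"
  obtains t where "t \<in> {0<..T}" "V t = 0" "\<And>s. s \<in> {0..<t} \<Longrightarrow> V s > 0"
proof -
  have contT: "continuous_on {0..t} V" if "t \<le> T" for t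
    using cont by (rule continuous_on_subset) (use that in auto)
  obtain z where z: "0 \<le> z" "z \<le> t0" "V z = 0"
    using IVT2'[of V t0 0 0] V0 t0 contT[of t0] by auto
  define Z where "Z = {0..T} \<inter> V -` {0}"
  have "compact Z" unfolding Z_def by (intro compact_level_Icc cont) auto
  moreover have "z \<in> Z" using z t0 by (auto simp: Z_def)
  then have "Z \<noteq> {}" by blast
  ultimately obtain t where t: "t \<in> Z" "\<And>s. s \<in> Z \<Longrightarrow> t \<le> s"
    using compact_attains_inf by meson
  have "V s > 0" if s: "s \<in> {0..<t}" for s
  proof (rule ccontr)
    assume "\<not> V s > 0"
    then obtain r where "0 \<le> r" "r \<le> s" "V r = 0"
      using IVT2'[of V s 0 0] V0 s t contT[of s] by (auto simp: Z_def)
    then show False using t(2)[of r] s t(1) by (auto simp: Z_def)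
  qed
  moreover have "t \<in> {0<..T}" using t(1) V0 by (auto simp: Z_def less_le)
  ultimately show ?thesis using that t(1) by (auto simp: Z_def)
qed

text \<open>
  At the last time at which \<open>W \<le> w\<close> holds, \<open>W\<close> would equal \<open>w\<close> and be about to decrease.
\<close>

lemma barrier_above:
  fixes W :: "real \<Rightarrow> real"
  assumes sub: "{s..e} \<subseteq> S"
    and der: "\<And>t. t \<in> {s..e} \<Longrightarrow> (W has_real_derivative V t) (at t within S)"
    and start: "W s \<le> w" and neg: "\<And>t. t \<in> {s..e} \<Longrightarrow> W t = w \<Longrightarrow> V t < 0"
    and t: "t \<in> {s..e}"
  shows "W t \<le> w"
proof (rule ccontr)
  assume "\<not> W t \<le> w"
  then have Wt: "W t > w" by simp
  have "continuous_on S' W" if "S' \<subseteq> {s..e}" for S'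
  proof -
    have "continuous (at u within S') W" if "u \<in> S'" for u
      using DERIV_continuous[OF has_field_derivative_subset[OF der, of u S']]
        \<open>S' \<subseteq> {s..e}\<close> sub that by blast
    then show ?thesis by (simp add: continuous_on_eq_continuous_within)
  qed
  then have cont: "continuous_on {u..t} W" if "u \<ge> s" for u
    using that t by auto
  have "compact ({s..t} \<inter> W -` {..w})"
    using cont[of s] by (intro compact_level_Icc) auto
  moreover have "{s..t} \<inter> W -` {..w} \<noteq> {}" using start t by auto
  ultimately have "\<exists>u\<in>{s..t} \<inter> W -` {..w}. \<forall>r\<in>{s..t} \<inter> W -` {..w}. r \<le> u"
    by (rule compact_attains_sup)
  then obtain u where u: "u \<in> {s..t}" "W u \<le> w" "\<And>r. r \<in> {s..t} \<Longrightarrow> W r \<le> w \<Longrightarrow> r \<le> u"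
    by auto
  obtain r where "u \<le> r" "r \<le> t" "W r = w"
    using IVT'[of W u w t] u Wt cont[of u] by auto
  then have Wu: "W u = w" using u(1) u(3)[of r] by auto
  have "u \<noteq> t" using Wu Wt by auto
  then have ut: "u < t" using u(1) by auto
  have "V u < 0" using neg[of u] u(1) t Wu by auto
  moreover have "(W has_real_derivative V u) (at u within S)" using der u(1) t by auto
  ultimately obtain d where d: "d > 0" "\<And>h. 0 < h \<Longrightarrow> u + h \<in> S \<Longrightarrow> h < d \<Longrightarrow> W u > W (u + h)"
    using has_real_derivative_neg_dec_right by meson
  define h where "h = min (d / 2) (t - u)"
  have h: "0 < h" "h < d" "u + h \<in> {s..t}" using d(1) ut u(1) by (auto simp: h_def)
  then have "W (u + h) \<le> w" using d(2)[of h] Wu sub t by (auto simp: less_imp_le subset_iff)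
  then show False using u(3)[OF h(3)] h(1) by auto
qed

lemma barrier_below:
  fixes W :: "real \<Rightarrow> real"
  assumes "{s..e} \<subseteq> S"
    and "\<And>t. t \<in> {s..e} \<Longrightarrow> (W has_real_derivative V t) (at t within S)"
    and "W s \<ge> w" and "\<And>t. t \<in> {s..e} \<Longrightarrow> W t = w \<Longrightarrow> V t > 0"
    and "t \<in> {s..e}"
  shows "W t \<ge> w"
proof -
  have "- W t \<le> - w"
    by (rule barrier_above[OF assms(1), of "\<lambda>t. - W t" "\<lambda>t. - V t"])
       (use assms in \<open>auto intro!: DERIV_minus\<close>)
  then show ?thesis by simp
qed

section \<open>The rescaled system and its a priori bounds\<close>

text \<open>
  Here \<open>B\<close> stands for \<open>\<beta>\<close> and \<open>a\<close> for \<open>\<alpha> + \<beta>\<close>.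
\<close>

locale interface_system =
  fixes m p \<sigma> a B :: real
  assumes p1: "1 < p" and pm: "p < m" and \<sigma>: "0 < \<sigma>" and a: "0 < a" and B: "0 < B"
begin

text \<open>
  The right-hand side for \<open>W'\<close>. Its first summand is the boundary term that integrating the drift
  \<open>\<beta> \<xi> f'\<close> by parts produces; \<open>U\<close> collects what remains under the integral.
\<close>

definition flux :: "(real \<Rightarrow> real) \<Rightarrow> (real \<Rightarrow> real) \<Rightarrow> real \<Rightarrow> real" where
  "flux W U t = B * (1 - t) * W t powr (1/m) + U t"

definition orbit :: "real \<Rightarrow> (real \<Rightarrow> real) \<Rightarrow> (real \<Rightarrow> real) \<Rightarrow> bool" where
  "orbit lam W U \<longleftrightarrow> U 0 = 0 \<and>
    (\<forall>t\<in>{0..1}. 0 \<le> W t \<and>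
      (W has_real_derivative flux W U t) (at t within {0..1}) \<and>
      (U has_real_derivative a * W t powr (1/m) - lam * (1 - t) powr \<sigma> * W t powr (p/m))
        (at t within {0..1}))"

lemma m1: "1 < m" using p1 pm by simp

lemma orbit_continuous:
  assumes "orbit lam W U"
  shows "continuous_on {0..1} W" "continuous_on {0..1} U" "continuous_on {0..1} (flux W U)"
    "continuous_on {0..1} (\<lambda>t. W t powr (1/m))"
proof -
  show W: "continuous_on {0..1} W" and U: "continuous_on {0..1} U"
    using assms unfolding orbit_def continuous_on_eq_continuous_within
    by (meson DERIV_continuous)+
  show phi: "continuous_on {0..1} (\<lambda>t. W t powr (1/m))"
    using W assms m1 by (intro continuous_on_powr') (auto simp: orbit_def)
  show "continuous_on {0..1} (flux W U)"
    unfolding flux_def by (intro continuous_intros U phi)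
qed

text \<open>
  The positive solution of \<open>X\<^sup>m = (1 + a + B) X\<close>.
\<close>

definition sup_bound :: real where
  "sup_bound = (1 + a + B) powr (1 / (m - 1))"

lemma sup_bound_ge_1: "sup_bound \<ge> 1"
  using m1 a B by (auto simp: sup_bound_def intro: ge_one_powr_ge_zero)

text \<open>
  The reaction only lowers \<open>W\<close>, so it may be dropped: at the maximum of \<open>W\<close>, with \<open>X = \<phi>\<close> there, this
  leaves \<open>X\<^sup>m \<le> 1 + (a + B) X\<close>. As \<open>m > 1\<close>, this bounds \<open>X\<close> independently of \<open>lam\<close>.
\<close>

lemma orbit_bounded:
  assumes orb: "orbit lam W U" and lam: "lam \<ge> 0" and W0: "W 0 \<le> 1" and t: "t \<in> {0..1}"
  shows "W t powr (1/m) \<le> sup_bound"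
proof -
  note C = orbit_continuous[OF orb]
  note O = orb[unfolded orbit_def]
  obtain tm where tm: "tm \<in> {0..1}" "\<And>t. t \<in> {0..1} \<Longrightarrow> W t \<le> W tm"
    using continuous_attains_sup[OF compact_Icc _ C(1)] by auto
  define X where "X = W tm powr (1/m)"
  have X0: "X \<ge> 0" by (simp add: X_def)
  have phiX: "W t powr (1/m) \<le> X" if "t \<in> {0..1}" for t
    using tm that O m1 unfolding X_def by (intro powr_mono2) auto
  have U: "U t \<le> a * X" if t: "t \<in> {0..1}" for t
  proof -
    have "U t - U 0 \<le> a * X * (t - 0)"
    proof (rule growth_le[where S = "{0..1}"])
      fix s assume "s \<in> {0<..<t}"
      then have s: "s \<in> {0..1}" using t by auto
      have "a * W s powr (1/m) \<le> a * X" using a phiX[OF s] by (intro mult_left_mono) auto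
      moreover have "0 \<le> lam * (1 - s) powr \<sigma> * W s powr (p/m)" using lam by auto
      ultimately show "a * W s powr (1/m) - lam * (1 - s) powr \<sigma> * W s powr (p/m) \<le> a * X"
        by linarith
    qed (use O t in auto)
    also have "a * X * (t - 0) \<le> a * X" using t a X0 by (simp add: mult_left_le)
    finally show ?thesis using O by auto
  qed
  have "W tm - W 0 \<le> (a + B) * X * (tm - 0)"
  proof (rule growth_le[where S = "{0..1}"])
    fix s assume "s \<in> {0<..<tm}"
    then have s: "s \<in> {0..1}" using tm by auto
    have "B * (1 - s) * W s powr (1/m) \<le> B * X"
      using s B phiX[OF s] by (intro mult_mono) (auto simp: mult_left_le)
    then show "flux W U s \<le> (a + B) * X" using U[OF s] by (simp add: flux_def algebra_simps)
  qed (use O tm in auto)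
  also have "\<dots> \<le> (a + B) * X" using tm(1) a B X0 by (simp add: mult_left_le)
  finally have Wtm: "W tm \<le> 1 + (a + B) * X" using W0 by simp
  have "X \<le> sup_bound"
  proof (cases "X \<le> 1")
    case False
    have "X powr m = W tm" using m1 O tm(1) by (auto simp: X_def powr_powr)
    moreover have "X powr m = X * X powr (m - 1)" using False by (simp add: powr_mult_base)
    ultimately have "X * X powr (m - 1) \<le> X * (1 + a + B)"
      using Wtm False by (simp add: algebra_simps)
    then have "X powr (m - 1) \<le> 1 + a + B" using False by simp
    then have "(X powr (m - 1)) powr (1 / (m - 1)) \<le> sup_bound"
      unfolding sup_bound_def using m1 by (intro powr_mono2) auto
    then show ?thesis using m1 False by (simp add: powr_powr)
  qed (use sup_bound_ge_1 in simp)
  then show ?thesis using phiX[OF t] by simp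
qed

text \<open>
  As long as the flux is positive, \<open>\<phi>\<close> is increasing, so the reaction accumulated up to time \<open>t\<close> is at
  most \<open>lam t \<phi>\<^sup>p\<close> with \<open>\<phi>\<close> taken at \<open>t\<close>. The hypothesis on \<open>\<tau>\<close> makes this at most a quarter of
  \<open>B \<phi>\<close>, and the drift wins: the flux stays above \<open>(B / 2) \<phi>\<close> and cannot have a first zero. The
  resulting inequality \<open>W' \<ge> (B / 2) W\<^bsup>1/m\<^esup>\<close> integrates to growth from the interface, with a rate that
  does not depend on \<open>W 0\<close>.
\<close>

lemma orbit_start:
  assumes orb: "orbit lam W U" and lam: "lam \<ge> 0" and W0: "W 0 > 0"
    and \<tau>: "\<tau> \<le> 1/4" and X: "X \<ge> 0" "lam * \<tau> * X powr (p - 1) \<le> B / 4"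
    and phiX: "\<And>t. t \<in> {0..\<tau>} \<Longrightarrow> W t powr (1/m) \<le> X" and t: "t \<in> {0..\<tau>}"
  shows "flux W U t \<ge> B / 2 * W t powr (1/m)" "W t \<ge> W 0"
    "W t powr (1 - 1/m) \<ge> (1 - 1/m) * (B / 2) * t"
proof -
  note C = orbit_continuous[OF orb]
  note O = orb[unfolded orbit_def]
  have step: "flux W U t \<ge> B / 2 * W t powr (1/m) \<and> W t \<ge> W 0"
    if t: "t \<in> {0..\<tau>}" and pos: "\<And>s. s \<in> {0..<t} \<Longrightarrow> flux W U s > 0" for t
  proof -
    have t1: "t \<in> {0..1}" using t \<tau> by auto
    have mono: "W s \<le> W t" if s: "s \<in> {0..t}" for s
    proof -
      have "W t - W s \<ge> 0 * (t - s)"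
        using O pos s t1 by (intro growth_ge[where S = "{0..1}" and f' = "flux W U"]) (auto intro: less_imp_le)
      then show ?thesis by simp
    qed
    define y where "y = W t powr (1/m)"
    have y0: "y > 0" using mono[of 0] W0 t by (auto simp: y_def)
    have yX: "y \<le> X" using phiX[OF t] by (simp add: y_def)
    have "U t - U 0 \<ge> - (lam * y powr p) * (t - 0)"
    proof (rule growth_ge[where S = "{0..1}"])
      fix s assume s: "s \<in> {0<..<t}"
      then have s1: "s \<in> {0..1}" using t1 by auto
      have "W s powr (p/m) \<le> W t powr (p/m)"
        using mono[of s] s O s1 p1 m1 by (intro powr_mono2) auto
      also have "\<dots> = y powr p" by (simp add: y_def powr_powr)
      finally have "W s powr (p/m) \<le> y powr p" .
      moreover have "(1 - s) powr \<sigma> \<le> 1" using s1 \<sigma> by (intro powr_le1) auto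
      ultimately have "(1 - s) powr \<sigma> * W s powr (p/m) \<le> 1 * y powr p"
        by (intro mult_mono) auto
      then have "lam * ((1 - s) powr \<sigma> * W s powr (p/m)) \<le> lam * y powr p"
        using lam by (intro mult_left_mono) auto
      moreover have "0 \<le> a * W s powr (1/m)" using a by simp
      ultimately show "- (lam * y powr p) \<le> a * W s powr (1/m) - lam * (1 - s) powr \<sigma> * W s powr (p/m)"
        by (simp add: mult.assoc)
    qed (use O t1 in auto)
    then have U: "U t \<ge> - (lam * t * y powr p)" using O by (simp add: algebra_simps)
    have "lam * t * y powr p = lam * t * y powr (p - 1) * y"
      using y0 powr_mult_base[of y "p - 1"] by (simp add: mult_ac)
    also have "lam * t * y powr (p - 1) \<le> lam * \<tau> * X powr (p - 1)"
      using lam t yX y0 p1 by (intro mult_mono powr_mono2) auto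
    then have "lam * t * y powr (p - 1) * y \<le> B / 4 * y"
      using X(2) y0 by (intro mult_right_mono) auto
    finally have "U t \<ge> - (B / 4 * y)" using U by linarith
    moreover have "B * (1 - t) * y \<ge> B * (3/4) * y"
      using t \<tau> B y0 by (intro mult_right_mono mult_left_mono) auto
    ultimately have "flux W U t \<ge> B / 2 * y" by (simp add: flux_def y_def)
    then show ?thesis using mono[of 0] t by (simp add: y_def)
  qed
  have pos: "flux W U t > 0" if t: "t \<in> {0..\<tau>}" for t
  proof (rule ccontr)
    assume neg: "\<not> flux W U t > 0"
    have "continuous_on {0..\<tau>} (flux W U)"
      using C(3) by (rule continuous_on_subset) (use \<tau> in auto)
    moreover have "flux W U 0 > 0" using W0 B O by (simp add: flux_def)
    ultimately obtain t' where t': "t' \<in> {0<..\<tau>}" "flux W U t' = 0" "\<And>s. s \<in> {0..<t'} \<Longrightarrow> flux W U s > 0"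
      using first_zero[of \<tau> "flux W U" t] t neg by auto
    then have "B / 2 * W t' powr (1/m) \<le> 0" "W t' > 0" using step[of t'] W0 by auto
    then show False using B by (simp add: mult_le_0_iff)
  qed
  have all: "flux W U s \<ge> B / 2 * W s powr (1/m) \<and> W s \<ge> W 0" if "s \<in> {0..\<tau>}" for s
    using step[OF that] pos that by auto
  then show "flux W U t \<ge> B / 2 * W t powr (1/m)" "W t \<ge> W 0" using t by auto
  have "W t powr (1 - 1/m) - W 0 powr (1 - 1/m) \<ge> (1 - 1/m) * (B / 2) * (t - 0)"
  proof (rule growth_ge[where S = "{0..1}" and f = "\<lambda>s. W s powr (1 - 1/m)"
          and f' = "\<lambda>s. (1 - 1/m) * W s powr (1 - 1/m - 1) * flux W U s"])
    show "((\<lambda>s. W s powr (1 - 1/m)) has_real_derivative (1 - 1/m) * W s powr (1 - 1/m - 1) * flux W U s)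
        (at s within {0..1})" if s: "s \<in> {0..t}" for s
    proof (rule DERIV_chain2[where f = "\<lambda>z. z powr (1 - 1/m)" and g = W])
      show "((\<lambda>z. z powr (1 - 1/m)) has_real_derivative (1 - 1/m) * W s powr (1 - 1/m - 1)) (at (W s))"
        using all[of s] s t W0 by (intro has_real_derivative_powr) auto
      show "(W has_real_derivative flux W U s) (at s within {0..1})" using O s t \<tau> by auto
    qed
    fix s assume s: "s \<in> {0<..<t}"
    have Ws: "W s > 0" using all[of s] s t W0 by auto
    have "B / 2 = W s powr (- (1/m)) * (B / 2 * W s powr (1/m))"
      using Ws by (simp add: powr_minus field_simps)
    also have "\<dots> \<le> W s powr (- (1/m)) * flux W U s"
      using all[of s] s t by (intro mult_left_mono) auto
    finally have "(1 - 1/m) * (B / 2) \<le> (1 - 1/m) * (W s powr (- (1/m)) * flux W U s)"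
      using m1 by (intro mult_left_mono) auto
    then show "(1 - 1/m) * (B / 2) \<le> (1 - 1/m) * W s powr (1 - 1/m - 1) * flux W U s"
      by (simp add: mult.assoc)
  qed (use t \<tau> in auto)
  then have "(1 - 1/m) * (B / 2) * t \<le> W t powr (1 - 1/m) - W 0 powr (1 - 1/m)"
    by (simp only: diff_zero)
  also have "\<dots> \<le> W t powr (1 - 1/m)" by simp
  finally show "W t powr (1 - 1/m) \<ge> (1 - 1/m) * (B / 2) * t" .
qed

end

section \<open>Extinction for a large parameter\<close>

lemma eventually_powr_ge: "0 < q \<Longrightarrow> \<forall>\<^sub>F x::real in at_top. C \<le> x powr q"
  by real_asymp

context interface_system
begin

text \<open>
  Suppose \<open>W\<close> stays positive, and let \<open>J t\<close> be half of the reaction accumulated up to \<open>t\<close>, with the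
  weight \<open>(1 - t)\<^sup>\<sigma>\<close> replaced by its lower bound \<open>c\<close> on \<open>[0, 1/2]\<close>. Then \<open>J' = a \<Theta> (\<phi> / \<Theta>)\<^sup>p\<close>, where \<open>\<Theta>\<close> is
  the height at which the growth \<open>a \<phi>\<close> balances \<open>J'\<close>; \<open>lam\<close> is defined through \<open>\<Theta>\<close>, and \<open>\<Theta>\<close> is
  small when \<open>lam\<close> is large. Splitting the reaction into two halves and absorbing the growth into one
  of them gives \<open>W' \<le> B \<phi> + a \<Theta> - J\<close> up to time \<open>1/2\<close>.

  \<^item> By time \<open>1/8\<close> the solution exceeds a large multiple \<open>X = K \<Theta>\<close> of the balance height
    (\<open>orbit_start\<close>), and therefore \<open>J\<close> is at least a fixed multiple of \<open>X\<close> by time \<open>1/4\<close>: otherwise the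
    accumulated reaction would be too weak to bring \<open>\<phi>\<close> below \<open>X\<close> again, and staying above \<open>X\<close> makes \<open>J\<close>
    large.
  \<^item> Then \<open>\<phi> \<le> \<theta> J\<close> at some time in \<open>[1/4, 3/8]\<close>, because \<open>\<phi> \<ge> \<theta> J\<close> turns \<open>J' = a \<Theta> (\<phi> / \<Theta>)\<^sup>p\<close> into
    a superlinear inequality for \<open>J\<close>, which blows up before \<open>3/8\<close> when \<open>K\<close> is large.
  \<^item> From that time on \<open>J\<close> dominates both other terms, so \<open>W\<close> falls at least at the rate \<open>J / 2\<close>. As
    \<open>W = \<phi> \<phi>\<^bsup>m-1\<^esup>\<close> is at most \<open>J / 16\<close> there, it reaches zero by time \<open>1/2\<close>.
\<close>

lemma no_positive_orbit:
  "\<exists>lam>0. \<forall>W U. orbit lam W U \<longrightarrow> 0 < W 0 \<longrightarrow> W 0 \<le> 1 \<longrightarrow> (\<exists>t\<in>{0..1}. W t \<le> 0)"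
proof -
  define c where "c = (1/2::real) powr \<sigma>"
  have c: "0 < c" "c \<le> 1" using \<sigma> by (auto simp: c_def intro: powr_le1)
  \<comment> \<open>Small enough for \<open>\<phi> \<le> \<theta> J\<close> to imply \<open>B \<phi> \<le> J / 4\<close> and \<open>W \<le> J / 16\<close>.\<close>
  define \<theta> where "\<theta> = min (1 / (4 * B)) (1 / (16 * sup_bound powr (m - 1)))"
  have S0: "0 < sup_bound powr (m - 1)" using sup_bound_ge_1 by simp
  have \<theta>: "0 < \<theta>" "B * \<theta> \<le> 1/4" "\<theta> * sup_bound powr (m - 1) \<le> 1/16"
  proof -
    show "0 < \<theta>" using B S0 by (simp add: \<theta>_def)
    have "\<theta> \<le> 1 / (4 * B)" "\<theta> \<le> 1 / (16 * sup_bound powr (m - 1))" by (auto simp: \<theta>_def)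
    then show "B * \<theta> \<le> 1/4" "\<theta> * sup_bound powr (m - 1) \<le> 1/16"
      using B S0 by (auto simp: field_simps)
  qed
  define c1 where "c1 = B * c / 8"
  have c1: "0 < c1" using B c by (simp add: c1_def)
  \<comment> \<open>In this order: positivity, the lower bound for \<open>J\<close> at \<open>1/4\<close>, \<open>a \<Theta> \<le> J / 4\<close>, and the blow-up before \<open>3/8\<close>.\<close>
  have "\<forall>\<^sub>F K in at_top. K > 0 \<and> 8 * c1 / a \<le> K powr (p - 1) \<and> 4 * a / c1 \<le> K \<and>
      16 / ((p - 1) * a * \<theta> powr p * c1 powr (p - 1)) \<le> K powr (p - 1)"
    using p1 by (intro eventually_conj eventually_gt_at_top eventually_ge_at_top eventually_powr_ge) auto
  then obtain K where K: "K > 0" "8 * c1 / a \<le> K powr (p - 1)" "4 * a / c1 \<le> K"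
      "16 / ((p - 1) * a * \<theta> powr p * c1 powr (p - 1)) \<le> K powr (p - 1)"
    by (metis (mono_tags, lifting) eventually_at_top_linorder order_refl)
  \<comment> \<open>Short enough for \<open>orbit_start\<close> to apply with the height \<open>K \<Theta>\<close>. It involves \<open>K\<close> but not \<open>\<Theta>\<close>, which is chosen afterwards.\<close>
  define \<tau> where "\<tau> = min (1/8) (B * c / (8 * a * K powr (p - 1)))"
  have \<tau>: "0 < \<tau>" "\<tau> \<le> 1/8" "\<tau> * (8 * a * K powr (p - 1)) \<le> B * c"
  proof -
    have Kp: "0 < 8 * a * K powr (p - 1)" using K(1) a by simp
    show "0 < \<tau>" "\<tau> \<le> 1/8" using B c Kp by (auto simp: \<tau>_def)
    have "\<tau> \<le> B * c / (8 * a * K powr (p - 1))" by (simp add: \<tau>_def)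
    then show "\<tau> * (8 * a * K powr (p - 1)) \<le> B * c" using Kp by (simp add: pos_le_divide_eq)
  qed
  define b where "b = (1 - 1/m) * (B / 2)"
  have b: "b > 0" using m1 B by (simp add: b_def)
  \<comment> \<open>A height below the one that \<open>orbit_start\<close> guarantees at time \<open>\<tau>\<close>.\<close>
  define X where "X = (b * \<tau> / 2) powr (1 / (m - 1))"
  have X: "X > 0" "X powr (m - 1) < b * \<tau>"
    using b \<tau> m1 by (auto simp: X_def powr_powr)
  define \<Theta> where "\<Theta> = X / K"
  have \<Theta>: "\<Theta> > 0" "X = K * \<Theta>" using X K by (auto simp: \<Theta>_def)
  define lam where "lam = 2 * a / (c * \<Theta> powr (p - 1))"
  have lam: "lam > 0" using a c \<Theta> by (simp add: lam_def)
  have lam_eq: "lam * c / 2 = a / \<Theta> powr (p - 1)"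
    using c \<Theta> by (simp add: lam_def field_simps)
  have "\<exists>t\<in>{0..1}. W t \<le> 0" if orb: "orbit lam W U" and W0: "0 < W 0" "W 0 \<le> 1" for W U
  proof (rule ccontr)
    assume "\<not> (\<exists>t\<in>{0..1}. W t \<le> 0)"
    then have Wpos: "W t > 0" if "t \<in> {0..1}" for t using that by force
    note C = orbit_continuous[OF orb]
    note O = orb[unfolded orbit_def]
    define y where "y t = W t powr (1/m)" for t
    have ypos: "y t > 0" if "t \<in> {0..1}" for t using Wpos[OF that] by (simp add: y_def)
    have yS: "y t \<le> sup_bound" if "t \<in> {0..1}" for t
      using orbit_bounded[OF orb _ W0(2) that] lam by (simp add: y_def)
    have yp: "W t powr (p/m) = y t powr p" for t by (simp add: y_def powr_powr)
    have ym: "W t = y t powr m" if "t \<in> {0..1}" for t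
      using Wpos[OF that] m1 by (simp add: y_def powr_powr)
    have Wder: "(W has_real_derivative B * (1 - t) * y t + U t) (at t within {0..1})" if "t \<in> {0..1}" for t
      using O that by (simp add: flux_def y_def)
    have Uder: "(U has_real_derivative a * y t - lam * (1 - t) powr \<sigma> * y t powr p) (at t within {0..1})"
      if "t \<in> {0..1}" for t
      using O that by (simp add: yp y_def)
    have conty: "continuous_on {0..1} (\<lambda>t. y t powr p)"
    proof (rule continuous_on_powr')
      show "continuous_on {0..1} y" using C(4) unfolding y_def[abs_def] .
      show "\<forall>t\<in>{0..1}. 0 \<le> y t \<and> (y t = 0 \<longrightarrow> 0 < p)" using ypos p1 by (auto intro: less_imp_le)
    qed (rule continuous_on_const)
    define J where "J t = integral {0..t} (\<lambda>s. lam * c / 2 * y s powr p)" for t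
    have Jder: "(J has_real_derivative lam * c / 2 * y t powr p) (at t within {0..1})" if "t \<in> {0..1}" for t
      unfolding J_def has_real_derivative_iff_has_vector_derivative
      by (rule integral_has_vector_derivative[OF _ that]) (intro continuous_intros conty)
    have J0: "J 0 = 0" by (simp add: J_def)
    have Jmono: "J s \<le> J t" if "0 \<le> s" "s \<le> t" "t \<le> 1" for s t
    proof -
      have "J t - J s \<ge> 0 * (t - s)"
        using that lam c by (intro growth_ge[where S = "{0..1}" and f = J, OF _ _ Jder]) auto
      then show ?thesis by simp
    qed
    have weight: "c \<le> (1 - t) powr \<sigma>" "(1 - t) powr \<sigma> \<le> 1" if "0 \<le> t" "t \<le> 1/2" for t
      using that \<sigma> unfolding c_def by (auto intro: powr_mono2 powr_le1)
    have U_upper: "U t \<le> a * \<Theta> - J t" if t: "0 \<le> t" "t \<le> 1/2" for t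
    proof -
      have "(U t + J t) - (U 0 + J 0) \<le> a * \<Theta> * (t - 0)"
      proof (rule growth_le[where S = "{0..1}" and f = "\<lambda>t. U t + J t"])
        show "((\<lambda>t. U t + J t) has_real_derivative
            (a * y s - lam * (1 - s) powr \<sigma> * y s powr p) + lam * c / 2 * y s powr p) (at s within {0..1})"
          if "s \<in> {0..t}" for s
          using that t by (intro DERIV_add Uder Jder) auto
        fix s assume s: "s \<in> {0<..<t}"
        then have s1: "s \<in> {0..1}" using t by auto
        have "lam * c * y s powr p \<le> lam * (1 - s) powr \<sigma> * y s powr p"
          using weight(1)[of s] s t lam by (intro mult_right_mono mult_left_mono) auto
        moreover have "lam * c * y s powr p = 2 * (lam * c / 2 * y s powr p)" by simp
        ultimately have 1: "(a * y s - lam * (1 - s) powr \<sigma> * y s powr p) + lam * c / 2 * y s powr p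
            \<le> a * y s - lam * c / 2 * y s powr p" by linarith
        have "y s powr p = y s * y s powr (p - 1)" using ypos[OF s1] by (simp add: powr_mult_base)
        then have 2: "a * y s - lam * c / 2 * y s powr p = a * y s * (1 - (y s / \<Theta>) powr (p - 1))"
          unfolding lam_eq using \<Theta> ypos[OF s1] by (simp add: powr_divide algebra_simps)
        \<comment> \<open>The growth is absorbed above the height \<open>\<Theta>\<close> and at most \<open>a \<Theta>\<close> below it.\<close>
        have 3: "a * y s * (1 - (y s / \<Theta>) powr (p - 1)) \<le> a * \<Theta>"
        proof (cases "y s \<le> \<Theta>")
          case True
          have "a * y s * (1 - (y s / \<Theta>) powr (p - 1)) \<le> a * \<Theta> * 1"
            using True a ypos[OF s1] \<Theta> p1 by (intro mult_mono) (auto intro!: powr_le1 mult_nonneg_nonneg)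
          then show ?thesis by simp
        next
          case False
          then have "(y s / \<Theta>) powr (p - 1) \<ge> 1" using \<Theta> p1 by (intro ge_one_powr_ge_zero) auto
          then have "a * y s * (1 - (y s / \<Theta>) powr (p - 1)) \<le> 0"
            using a ypos[OF s1] by (intro mult_nonneg_nonpos) auto
          also have "0 \<le> a * \<Theta>" using a \<Theta> by simp
          finally show ?thesis .
        qed
        show "(a * y s - lam * (1 - s) powr \<sigma> * y s powr p) + lam * c / 2 * y s powr p \<le> a * \<Theta>"
          using 1 2 3 by linarith
      qed (use t in auto)
      moreover have "a * \<Theta> * t \<le> a * \<Theta>" using t a \<Theta> by (simp add: mult_left_le)
      ultimately show ?thesis using O J0 by simp
    qed
    have U_lower: "U t \<ge> - (2 / c) * J t" if t: "0 \<le> t" "t \<le> 1/2" for t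
    proof -
      have "(U t + 2 / c * J t) - (U 0 + 2 / c * J 0) \<ge> 0 * (t - 0)"
      proof (rule growth_ge[where S = "{0..1}" and f = "\<lambda>t. U t + 2 / c * J t"])
        show "((\<lambda>t. U t + 2 / c * J t) has_real_derivative
            (a * y s - lam * (1 - s) powr \<sigma> * y s powr p) + 2 / c * (lam * c / 2 * y s powr p)) (at s within {0..1})"
          if "s \<in> {0..t}" for s
          using that t by (intro DERIV_add DERIV_cmult Uder Jder) auto
        fix s assume s: "s \<in> {0<..<t}"
        then have s1: "s \<in> {0..1}" using t by auto
        have "lam * (1 - s) powr \<sigma> * y s powr p \<le> lam * 1 * y s powr p"
          using weight(2)[of s] s t lam by (intro mult_right_mono mult_left_mono) auto
        moreover have "2 / c * (lam * c / 2 * y s powr p) = lam * 1 * y s powr p" using c by simp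
        moreover have "0 \<le> a * y s" using a ypos[OF s1] by simp
        ultimately show "0 \<le> (a * y s - lam * (1 - s) powr \<sigma> * y s powr p) + 2 / c * (lam * c / 2 * y s powr p)"
          by linarith
      qed (use t in auto)
      then show ?thesis using O J0 by simp
    qed
    have Jstep: "J t - J s \<ge> lam * c / 2 * z powr p * (t - s)"
      if "0 \<le> s" "s \<le> t" "t \<le> 1" "0 \<le> z" "\<And>r. s < r \<Longrightarrow> r < t \<Longrightarrow> y r \<ge> z" for s t z
      using that lam c p1
      by (intro growth_ge[where S = "{0..1}" and f = J, OF _ _ Jder]) (auto intro!: mult_left_mono powr_mono2)

    have "\<exists>t1\<in>{0..\<tau>}. y t1 > X"
    proof (rule ccontr)
      assume "\<not> (\<exists>t1\<in>{0..\<tau>}. y t1 > X)"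
      then have le: "W t powr (1/m) \<le> X" if "t \<in> {0..\<tau>}" for t using that by (force simp: y_def)
      have "lam * \<tau> * X powr (p - 1) = 2 * a * K powr (p - 1) * \<tau> / c"
        using \<Theta> K c by (simp add: lam_def powr_mult)
      also have "\<dots> \<le> B / 4" using \<tau>(3) c by (simp add: field_simps)
      finally have "W \<tau> powr (1 - 1/m) \<ge> b * \<tau>"
        unfolding b_def using lam W0 \<tau> X le by (intro orbit_start(3)[OF orb, where X = X and \<tau> = \<tau>]) auto
      moreover have "W \<tau> powr (1 - 1/m) = y \<tau> powr (m - 1)"
        using m1 by (simp add: y_def powr_powr diff_divide_distrib)
      moreover have "y \<tau> powr (m - 1) \<le> X powr (m - 1)"
        using le[of \<tau>] \<tau> m1 by (intro powr_mono2) (auto simp: y_def)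
      ultimately show False using X by linarith
    qed
    then obtain t1 where t1: "0 \<le> t1" "t1 \<le> 1/8" "y t1 > X" using \<tau> by force

    have J1: "J (1/4) \<ge> c1 * X"
    proof (rule ccontr)
      assume "\<not> J (1/4) \<ge> c1 * X"
      then have Jlt: "J (1/4) < c1 * X" by simp
      have Wge: "W t \<ge> X powr m" if "t \<in> {t1..1/4}" for t
      proof (rule barrier_below[where W = W and S = "{0..1}" and s = t1 and e = "1/4" and V = "\<lambda>t. B * (1 - t) * y t + U t"])
        show "W t1 \<ge> X powr m" using ym[of t1] t1 X m1 by (auto intro!: powr_mono2)
        fix s assume s: "s \<in> {t1..1/4}" and "W s = X powr m"
        then have yX: "y s = X" using X m1 by (simp add: y_def powr_powr)
        have "J s < c1 * X" using Jmono[of s "1/4"] s t1 Jlt by simp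
        then have "2 / c * J s < 2 / c * (c1 * X)" using c by (intro mult_strict_left_mono) auto
        moreover have "2 / c * (c1 * X) = B * X / 4" using c by (simp add: c1_def)
        ultimately have "U s > - (B * X / 4)" using U_lower[of s] s t1 by auto
        moreover have "B * (3/4) * X \<le> B * (1 - s) * y s"
          unfolding yX using s t1 B X by (intro mult_right_mono mult_left_mono) auto
        then have "3 * (B * X / 4) \<le> B * (1 - s) * y s" by simp
        moreover have "B * X / 4 > 0" using B X by simp
        ultimately show "B * (1 - s) * y s + U s > 0" by linarith
      qed (use Wder that t1 in auto)
      have "y t \<ge> X" if "t1 < t" "t < 1/4" for t
      proof -
        have "(X powr m) powr (1/m) \<le> y t"
          unfolding y_def using Wge[of t] that m1 by (intro powr_mono2) auto
        then show ?thesis using X m1 by (simp add: powr_powr)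
      qed
      then have "J (1/4) - J t1 \<ge> lam * c / 2 * X powr p * (1/4 - t1)"
        using t1 X by (intro Jstep) auto
      moreover have "lam * c / 2 * X powr p * (1/4 - t1) \<ge> lam * c / 2 * X powr p * (1/8)"
        using t1 lam c by (intro mult_left_mono) auto
      moreover have "lam * c / 2 * X powr p = a * K powr (p - 1) * X"
      proof -
        have "X powr p = X * X powr (p - 1)" using X by (simp add: powr_mult_base)
        also have "X powr (p - 1) = K powr (p - 1) * \<Theta> powr (p - 1)" using \<Theta> K by (simp add: powr_mult)
        finally show ?thesis unfolding lam_eq using \<Theta>(1) by simp
      qed
      moreover have "J t1 \<ge> 0" using Jmono[of 0 t1] t1 J0 by simp
      moreover have "c1 * X \<le> a * K powr (p - 1) * X * (1/8)"
        using K(2) a X by (simp add: field_simps)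
      ultimately show False using Jlt by linarith
    qed
    have J1pos: "J t > 0" if "1/4 \<le> t" "t \<le> 1" for t
    proof -
      have "0 < c1 * X" using c1 X by simp
      also have "\<dots> \<le> J t" using J1 Jmono[of "1/4" t] that by simp
      finally show ?thesis .
    qed

    have "\<exists>t2\<in>{1/4..3/8}. y t2 \<le> \<theta> * J t2"
    proof (rule ccontr)
      assume "\<not> (\<exists>t2\<in>{1/4..3/8}. y t2 \<le> \<theta> * J t2)"
      then have big: "y t \<ge> \<theta> * J t" if "t \<in> {1/4..3/8}" for t using that by force
      define g where "g = (p - 1) * (a / \<Theta> powr (p - 1) * \<theta> powr p)"
      have "J (3/8) powr (1 - p) - J (1/4) powr (1 - p) \<le> - g * (3/8 - 1/4)"
      proof (rule growth_le[where S = "{0..1}" and f = "\<lambda>t. J t powr (1 - p)"])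
        show "((\<lambda>t. J t powr (1 - p)) has_real_derivative
            (1 - p) * J s powr (1 - p - 1) * (lam * c / 2 * y s powr p)) (at s within {0..1})"
          if s: "s \<in> {1/4..3/8}" for s
        proof (rule DERIV_chain2[where f = "\<lambda>z. z powr (1 - p)" and g = J])
          show "((\<lambda>z. z powr (1 - p)) has_real_derivative (1 - p) * J s powr (1 - p - 1)) (at (J s))"
            using J1pos[of s] s by (intro has_real_derivative_powr) auto
        qed (use Jder s in auto)
        fix s :: real assume s: "s \<in> {1/4<..<3/8}"
        have Js: "J s > 0" using J1pos[of s] s by auto
        have "(\<theta> * J s) powr p \<le> y s powr p"
          using big[of s] s \<theta> Js p1 by (intro powr_mono2) auto
        then have "J s powr (- p) * (\<theta> powr p * J s powr p) \<le> J s powr (- p) * y s powr p"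
          using \<theta> Js by (intro mult_left_mono) (auto simp: powr_mult)
        then have "\<theta> powr p \<le> J s powr (- p) * y s powr p"
          using Js by (simp add: powr_minus field_simps)
        then have "(p - 1) * (a / \<Theta> powr (p - 1)) * \<theta> powr p \<le>
            (p - 1) * (a / \<Theta> powr (p - 1)) * (J s powr (- p) * y s powr p)"
          using p1 a \<Theta> by (intro mult_left_mono) auto
        moreover have "(1 - p) * z * (A * q) = - ((p - 1) * A * (z * q))" for z A q :: real
          by (simp add: algebra_simps)
        moreover have "g = (p - 1) * (a / \<Theta> powr (p - 1)) * \<theta> powr p" by (simp add: g_def)
        ultimately show "(1 - p) * J s powr (1 - p - 1) * (lam * c / 2 * y s powr p) \<le> - g"
          unfolding lam_eq by simp
      qed auto
      moreover have "J (1/4) powr (1 - p) \<le> (c1 * X) powr (1 - p)"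
        using J1 c1 X p1 by (intro powr_mono2') auto
      moreover have "(c1 * X) powr (1 - p) < g / 8"
      proof -
        have "g * (c1 * X) powr (p - 1) = (p - 1) * a * \<theta> powr p * c1 powr (p - 1) * K powr (p - 1)"
          using \<Theta> K c1 by (simp add: g_def powr_mult)
        also have "\<dots> \<ge> 16" using K(4) p1 a \<theta> c1 by (simp add: pos_divide_le_eq mult_ac)
        finally have "1 < g / 8 * (c1 * X) powr (p - 1)" by simp
        moreover have "(c1 * X) powr (1 - p) = 1 / (c1 * X) powr (p - 1)"
          using powr_minus_divide[of "c1 * X" "p - 1"] by simp
        moreover have "(c1 * X) powr (p - 1) > 0" using c1 X by simp
        ultimately show ?thesis by (simp add: pos_divide_less_eq)
      qed
      moreover have "J (3/8) powr (1 - p) \<ge> 0" by simp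
      ultimately show False by simp
    qed
    then obtain t2 where t2: "1/4 \<le> t2" "t2 \<le> 3/8" "y t2 \<le> \<theta> * J t2" by auto
    define j where "j = J t2"
    have j: "j > 0" using J1pos[of t2] t2 by (simp add: j_def)
    have aj: "a * \<Theta> \<le> j / 4"
    proof -
      have "4 * (a * \<Theta>) \<le> c1 * X" using K(3) c1 \<Theta> by (simp add: field_simps)
      also have "\<dots> \<le> j" using J1 Jmono[of "1/4" t2] t2 by (simp add: j_def)
      finally show ?thesis by simp
    qed
    have fall: "B * (1 - t) * y t + U t \<le> - (j / 2)" if t: "t \<in> {t2..1/2}" and yt: "y t \<le> \<theta> * j" for t
    proof -
      have t01: "t \<in> {0..1}" using t t2 by auto
      have "B * (1 - t) * y t \<le> B * 1 * y t"
        using t01 B ypos[OF t01] by (intro mult_right_mono mult_left_mono) auto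
      also have "\<dots> \<le> B * (\<theta> * j)" using yt B by simp
      also have "\<dots> \<le> 1/4 * j"
        unfolding mult.assoc[symmetric] using \<theta>(2) j by (intro mult_right_mono) auto
      finally have "B * (1 - t) * y t \<le> j / 4" by simp
      moreover have "U t \<le> j / 4 - j" using U_upper[of t] aj Jmono[of t2 t] t t2 by (simp add: j_def)
      ultimately show ?thesis by linarith
    qed
    have small: "y t \<le> \<theta> * j" if t: "t \<in> {t2..1/2}" for t
    proof -
      have "W t \<le> (\<theta> * j) powr m"
      proof (rule barrier_above[where W = W and S = "{0..1}" and s = t2 and e = "1/2" and V = "\<lambda>t. B * (1 - t) * y t + U t"])
        show "W t2 \<le> (\<theta> * j) powr m"
          using ym[of t2] t2 ypos[of t2] m1 by (auto simp: j_def intro!: powr_mono2)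
        fix s assume s: "s \<in> {t2..1/2}" and "W s = (\<theta> * j) powr m"
        then have "y s = \<theta> * j" using \<theta> j m1 by (simp add: y_def powr_powr)
        then show "B * (1 - s) * y s + U s < 0" using fall[OF s] j by simp
      qed (use Wder t t2 in auto)
      then have "y t \<le> ((\<theta> * j) powr m) powr (1/m)"
        unfolding y_def using Wpos[of t] t t2 m1 by (intro powr_mono2) auto
      then show ?thesis using \<theta> j m1 by (simp add: powr_powr)
    qed
    have "W (1/2) - W t2 \<le> - (j / 2) * (1/2 - t2)"
      using t2 fall small
      by (intro growth_le[where S = "{0..1}" and f = W and f' = "\<lambda>t. B * (1 - t) * y t + U t"] Wder) auto
    also have "\<dots> \<le> - (j / 2) * (1/8)" using t2 j by (intro mult_left_mono_neg) auto
    finally have "W (1/2) \<le> W t2 - j / 16" by simp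
    moreover have "W t2 \<le> j / 16"
    proof -
      have "W t2 = y t2 * y t2 powr (m - 1)"
        using ym[of t2] ypos[of t2] t2 by (simp add: powr_mult_base)
      also have "\<dots> \<le> (\<theta> * j) * sup_bound powr (m - 1)"
        using t2 ypos[of t2] yS[of t2] \<theta> j m1 by (intro mult_mono powr_mono2) (auto simp: j_def)
      also have "\<dots> = \<theta> * sup_bound powr (m - 1) * j" by simp
      also have "\<dots> \<le> 1/16 * j" using \<theta>(3) j by (intro mult_right_mono) auto
      finally show ?thesis by simp
    qed
    ultimately show False using Wpos[of "1/2"] by simp
  qed
  then show ?thesis using lam by blast
qed

end

section \<open>Shooting from a positive height\<close>

lemma powr_lipschitz:
  fixes x y e q :: real
  assumes q: "0 < q" "q \<le> 1" and e: "0 < e" "e \<le> x" "e \<le> y"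
  shows "\<bar>x powr q - y powr q\<bar> \<le> e powr (q - 1) * \<bar>x - y\<bar>"
proof -
  have "norm (x powr q - y powr q) \<le> e powr (q - 1) * norm (x - y)"
  proof (rule field_differentiable_bound[where S = "{e..}"])
    show "((\<lambda>z. z powr q) has_field_derivative q * z powr (q - 1)) (at z within {e..})" if "z \<in> {e..}" for z
      by (rule has_field_derivative_at_within[OF has_real_derivative_powr]) (use that e in auto)
    show "norm (q * z powr (q - 1)) \<le> e powr (q - 1)" if "z \<in> {e..}" for z
    proof -
      have "q * z powr (q - 1) \<le> 1 * e powr (q - 1)"
        using that e q by (intro mult_mono powr_mono2') auto
      then show ?thesis using q by (simp add: abs_mult)
    qed
  qed (use e in auto)
  then show ?thesis by simp
qed

context interface_system
begin

definition field :: "real \<Rightarrow> real \<Rightarrow> real \<times> real \<Rightarrow> real \<times> real" where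
  "field lam t x = (B * (1 - t) * fst x powr (1/m) + snd x,
     a * fst x powr (1/m) - lam * (1 - t) powr \<sigma> * fst x powr (p/m))"

lemma field_continuous:
  "continuous_on (A \<times> {0..1} \<times> ({0..} \<times> UNIV)) (\<lambda>(l,t,x). field l t x)"
proof -
  define S where "S = A \<times> {0..1::real} \<times> ({0::real..} \<times> (UNIV :: real set))"
  have u: "continuous_on S (\<lambda>z. snd (snd (snd z)))"
    by (rule continuous_on_snd[OF continuous_on_snd[OF continuous_on_snd[OF continuous_on_id]]])
  have l: "continuous_on S (\<lambda>z. fst z)" by (rule continuous_on_fst[OF continuous_on_id])
  have t1: "continuous_on S (\<lambda>z. fst (snd z))"
    by (rule continuous_on_fst[OF continuous_on_snd[OF continuous_on_id]])
  have t': "continuous_on S (\<lambda>z. 1 - fst (snd z))"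
    by (rule continuous_on_diff[OF continuous_on_const t1])
  have w: "continuous_on S (\<lambda>z. fst (snd (snd z)) powr q)" if "q > 0" for q
    by (rule continuous_on_powr'[OF continuous_on_fst[OF continuous_on_snd[OF continuous_on_snd[OF continuous_on_id]]]
          continuous_on_const]) (use that in \<open>auto simp: S_def\<close>)
  have t: "continuous_on S (\<lambda>z. (1 - fst (snd z)) powr \<sigma>)"
    by (rule continuous_on_powr'[OF t' continuous_on_const]) (use \<sigma> in \<open>auto simp: S_def\<close>)
  have q: "0 < 1/m" "0 < p/m" using p1 m1 by auto
  have "continuous_on S (\<lambda>z. B * (1 - fst (snd z)) * fst (snd (snd z)) powr (1/m) + snd (snd (snd z)))"
    by (rule continuous_on_add[OF continuous_on_mult[OF continuous_on_mult[OF continuous_on_const t'] w[OF q(1)]] u])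
  moreover have "continuous_on S (\<lambda>z. a * fst (snd (snd z)) powr (1/m)
      - fst z * (1 - fst (snd z)) powr \<sigma> * fst (snd (snd z)) powr (p/m))"
    by (rule continuous_on_diff[OF continuous_on_mult[OF continuous_on_const w[OF q(1)]]
        continuous_on_mult[OF continuous_on_mult[OF l t] w[OF q(2)]]])
  ultimately show ?thesis
    unfolding field_def split_beta S_def[symmetric] by (rule continuous_on_Pair)
qed

lemma orbit_iff_field:
  "orbit lam W U \<longleftrightarrow> U 0 = 0 \<and> (\<forall>t\<in>{0..1}. 0 \<le> W t \<and>
     ((\<lambda>t. (W t, U t)) has_vector_derivative field lam t (W t, U t)) (at t within {0..1}))"
proof -
  have pair: "((\<lambda>t. (W t, U t)) has_vector_derivative (w, u)) (at t within S) \<longleftrightarrow>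
      (W has_real_derivative w) (at t within S) \<and> (U has_real_derivative u) (at t within S)" for w u t S
    unfolding has_real_derivative_iff_has_vector_derivative
  proof safe
    assume der: "((\<lambda>t. (W t, U t)) has_vector_derivative (w, u)) (at t within S)"
    show "(W has_vector_derivative w) (at t within S)"
      using bounded_linear.has_vector_derivative[OF bounded_linear_fst der] by simp
    show "(U has_vector_derivative u) (at t within S)"
      using bounded_linear.has_vector_derivative[OF bounded_linear_snd der] by simp
  qed (rule has_vector_derivative_Pair)
  show ?thesis
    by (simp only: orbit_def field_def flux_def fst_conv snd_conv pair)
qed

text \<open>
  Call a parameter bad if \<open>W\<close> gets down to \<open>\<epsilon>\<close> or the final flux \<open>U 1\<close> is not positive. Bad parameters
  form a compact set, which contains \<open>\<Lambda>\<close> but not \<open>0\<close>. At the smallest of them \<open>W \<ge> \<epsilon>\<close> and \<open>U 1 \<ge> 0\<close>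
  persist by continuity from below, so badness means \<open>U 1 = 0\<close> or that \<open>W\<close> attains its minimum
  \<open>\<epsilon>\<close>. The minimum is not at \<open>0\<close>, since \<open>W\<close> starts at \<open>2 \<epsilon>\<close>; nor at \<open>1\<close> unless \<open>U 1 = 0\<close>, since \<open>W\<close> would
  arrive there increasing; and at an interior minimum the flux vanishes.
\<close>

lemma shooting:
  assumes \<epsilon>: "0 < \<epsilon>" "2 * \<epsilon> \<le> 1" and \<Lambda>: "\<Lambda> > 0"
    and no: "\<And>W U. orbit \<Lambda> W U \<Longrightarrow> 0 < W 0 \<Longrightarrow> W 0 \<le> 1 \<Longrightarrow> \<exists>t\<in>{0..1}. W t \<le> 0"
  obtains lam W U t where "lam \<in> {0..\<Lambda>}" "orbit lam W U" "W 0 = 2 * \<epsilon>"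
    "t \<in> {0<..1}" "flux W U t = 0" "t = 1 \<or> W t = \<epsilon>"
proof -
  define F where "F l t x = field l t (max (fst x) \<epsilon>, snd x)" for l t x
  have contF: "continuous_on ({0..\<Lambda>} \<times> {0..1} \<times> UNIV) (\<lambda>(l,t,x). F l t x)"
  proof -
    define h :: "real \<times> real \<times> real \<times> real \<Rightarrow> real \<times> real \<times> real \<times> real"
      where "h z = (fst z, fst (snd z), max (fst (snd (snd z))) \<epsilon>, snd (snd (snd z)))" for z
    have "continuous_on ({0..\<Lambda>} \<times> {0..1} \<times> UNIV) h"
      unfolding h_def
      by (intro continuous_on_Pair continuous_on_max continuous_on_fst continuous_on_snd
          continuous_on_id continuous_on_const)
    moreover have "h ` ({0..\<Lambda>} \<times> {0..1} \<times> UNIV) \<subseteq> {0..\<Lambda>} \<times> {0..1} \<times> ({0..} \<times> UNIV)"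
      using \<epsilon> by (auto simp: h_def)
    ultimately have "continuous_on ({0..\<Lambda>} \<times> {0..1} \<times> UNIV) (\<lambda>z. (\<lambda>(l,t,x). field l t x) (h z))"
      by (rule continuous_on_compose2[OF field_continuous])
    then show ?thesis by (simp add: F_def h_def split_beta)
  qed
  define K1 where "K1 = \<epsilon> powr (1/m - 1)"
  define K2 where "K2 = \<epsilon> powr (p/m - 1)"
  have K: "K1 > 0" "K2 > 0" using \<epsilon> by (auto simp: K1_def K2_def)
  define L where "L = B * K1 + 1 + (a * K1 + \<Lambda> * K2)"
  have L: "L > 0" using B a \<Lambda> K by (simp add: L_def add_pos_pos)
  have lip: "norm (F l t x - F l t y) \<le> L * norm (x - y)" if l: "l \<in> {0..\<Lambda>}" and t: "t \<in> {0..1}" for l t x y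
  proof -
    define d where "d = norm (x - y)"
    have d1: "\<bar>fst x - fst y\<bar> \<le> d" and d2: "\<bar>snd x - snd y\<bar> \<le> d"
      unfolding d_def using dist_fst_le[of x y] dist_snd_le[of x y] by (auto simp: dist_norm)
    have d0: "d \<ge> 0" by (simp add: d_def)
    have dmax: "\<bar>max (fst x) \<epsilon> - max (fst y) \<epsilon>\<bar> \<le> d"
      using d1 d0 by (auto simp: max_def abs_le_iff)
    have q: "0 < 1/m" "1/m \<le> 1" "0 < p/m" "p/m \<le> 1" using m1 p1 pm by auto
    define D1 where "D1 = max (fst x) \<epsilon> powr (1/m) - max (fst y) \<epsilon> powr (1/m)"
    define D2 where "D2 = max (fst x) \<epsilon> powr (p/m) - max (fst y) \<epsilon> powr (p/m)"
    have D1: "\<bar>D1\<bar> \<le> K1 * d"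
      using powr_lipschitz[OF q(1,2) \<epsilon>(1) max.cobounded2 max.cobounded2, of "fst x" "fst y"]
        mult_left_mono[OF dmax less_imp_le[OF K(1)]] unfolding K1_def D1_def by (rule order_trans)
    have D2: "\<bar>D2\<bar> \<le> K2 * d"
      using powr_lipschitz[OF q(3,4) \<epsilon>(1) max.cobounded2 max.cobounded2, of "fst x" "fst y"]
        mult_left_mono[OF dmax less_imp_le[OF K(2)]] unfolding K2_def D2_def by (rule order_trans)
    have prod: "\<bar>u * v\<bar> \<le> b * c" if "\<bar>u\<bar> \<le> b" "\<bar>v\<bar> \<le> c" for u v b c :: real
      using that by (simp add: abs_mult mult_mono')
    have "(1 - t) powr \<sigma> \<le> 1" using t \<sigma> by (intro powr_le1) auto
    then have "l * (1 - t) powr \<sigma> \<le> \<Lambda> * 1" using l by (intro mult_mono) auto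
    then have w: "\<bar>l * (1 - t) powr \<sigma>\<bar> \<le> \<Lambda>" using l by simp
    have "\<bar>B * (1 - t)\<bar> \<le> B" using t B by (simp add: abs_mult mult_left_le)
    then have f: "\<bar>B * (1 - t) * D1 + (snd x - snd y)\<bar> \<le> B * (K1 * d) + d"
      using D1 d2 by (intro abs_triangle_ineq[THEN order_trans] add_mono prod)
    have s: "\<bar>a * D1 - l * (1 - t) powr \<sigma> * D2\<bar> \<le> a * (K1 * d) + \<Lambda> * (K2 * d)"
      using D1 D2 w a by (intro abs_triangle_ineq4[THEN order_trans] add_mono prod) auto
    have "F l t x - F l t y = (B * (1 - t) * D1 + (snd x - snd y), a * D1 - l * (1 - t) powr \<sigma> * D2)"
      by (simp add: F_def field_def D1_def D2_def algebra_simps)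
    then have "norm (F l t x - F l t y) \<le>
        \<bar>B * (1 - t) * D1 + (snd x - snd y)\<bar> + \<bar>a * D1 - l * (1 - t) powr \<sigma> * D2\<bar>"
      using norm_Pair_le[of "B * (1 - t) * D1 + (snd x - snd y)" "a * D1 - l * (1 - t) powr \<sigma> * D2"]
      by (simp only: real_norm_def)
    also have "\<dots> \<le> (B * (K1 * d) + d) + (a * (K1 * d) + \<Lambda> * (K2 * d))"
      by (rule add_mono[OF f s])
    also have "\<dots> = L * norm (x - y)" by (simp add: L_def d_def algebra_simps)
    finally show ?thesis .
  qed
  obtain x where contx: "continuous_on ({0..\<Lambda>} \<times> {0..1}) (\<lambda>(l,t). x l t)"
    and x0: "\<And>l. l \<in> {0..\<Lambda>} \<Longrightarrow> x l 0 = (2 * \<epsilon>, 0)"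
    and xder: "\<And>l t. l \<in> {0..\<Lambda>} \<Longrightarrow> t \<in> {0..1} \<Longrightarrow>
           (x l has_vector_derivative F l t (x l t)) (at t within {0..1})"
    using picard_lindelof_parameter[OF compact_Icc contF lip L, of "(2 * \<epsilon>, 0)"] by blast
  define W where "W l t = fst (x l t)" for l t
  define U where "U l t = snd (x l t)" for l t
  have xWU: "x l t = (W l t, U l t)" for l t by (simp add: W_def U_def)
  have start: "W l 0 = 2 * \<epsilon>" "U l 0 = 0" if "l \<in> {0..\<Lambda>}" for l
    using x0[OF that] by (auto simp: W_def U_def)
  have contW: "continuous_on ({0..\<Lambda>} \<times> {0..1}) (\<lambda>z. W (fst z) (snd z))"
    and contU: "continuous_on ({0..\<Lambda>} \<times> {0..1}) (\<lambda>z. U (fst z) (snd z))"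
    using continuous_on_fst[OF contx] continuous_on_snd[OF contx] by (simp_all add: W_def U_def split_beta)
  have contWt: "continuous_on {0..\<Lambda>} (\<lambda>l. W l t)" and contUt: "continuous_on {0..\<Lambda>} (\<lambda>l. U l t)"
    if "t \<in> {0..1}" for t
  proof -
    have p: "continuous_on {0..\<Lambda>} (\<lambda>l. (l, t))"
      by (intro continuous_on_Pair continuous_on_id continuous_on_const)
    have "(\<lambda>l. (l, t)) ` {0..\<Lambda>} \<subseteq> {0..\<Lambda>} \<times> {0..1}" using that by auto
    from continuous_on_compose2[OF contW p this] continuous_on_compose2[OF contU p this]
    show "continuous_on {0..\<Lambda>} (\<lambda>l. W l t)" "continuous_on {0..\<Lambda>} (\<lambda>l. U l t)" by simp_all
  qed
  have Wder: "(W l has_real_derivative B * (1 - t) * max (W l t) \<epsilon> powr (1/m) + U l t) (at t within {0..1})"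
    and Uder: "(U l has_real_derivative a * max (W l t) \<epsilon> powr (1/m)
        - l * (1 - t) powr \<sigma> * max (W l t) \<epsilon> powr (p/m)) (at t within {0..1})"
    if "l \<in> {0..\<Lambda>}" "t \<in> {0..1}" for l t
  proof -
    have "W l = (\<lambda>t. fst (x l t))" "U l = (\<lambda>t. snd (x l t))" by (simp_all add: W_def U_def fun_eq_iff)
    moreover have "F l t (x l t) = (B * (1 - t) * max (W l t) \<epsilon> powr (1/m) + U l t,
        a * max (W l t) \<epsilon> powr (1/m) - l * (1 - t) powr \<sigma> * max (W l t) \<epsilon> powr (p/m))"
      by (simp add: F_def field_def W_def U_def)
    ultimately show "(W l has_real_derivative B * (1 - t) * max (W l t) \<epsilon> powr (1/m) + U l t) (at t within {0..1})"
      and "(U l has_real_derivative a * max (W l t) \<epsilon> powr (1/m)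
        - l * (1 - t) powr \<sigma> * max (W l t) \<epsilon> powr (p/m)) (at t within {0..1})"
      using bounded_linear.has_vector_derivative[OF bounded_linear_fst xder[OF that]]
        bounded_linear.has_vector_derivative[OF bounded_linear_snd xder[OF that]]
      unfolding has_real_derivative_iff_has_vector_derivative by (simp_all only: fst_conv snd_conv)
  qed
  have orb: "orbit l (W l) (U l)" if l: "l \<in> {0..\<Lambda>}" and "\<And>t. t \<in> {0..1} \<Longrightarrow> W l t \<ge> \<epsilon>" for l
    unfolding orbit_def flux_def
  proof (intro conjI ballI)
    fix t :: real assume t: "t \<in> {0..1}"
    have ge: "max (W l t) \<epsilon> = W l t" using that(2)[OF t] by simp
    show "0 \<le> W l t" using that(2)[OF t] \<epsilon> by simp
    show "(W l has_real_derivative B * (1 - t) * W l t powr (1/m) + U l t) (at t within {0..1})"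
      using Wder[OF l t] by (simp only: ge)
    show "(U l has_real_derivative a * W l t powr (1/m) - l * (1 - t) powr \<sigma> * W l t powr (p/m)) (at t within {0..1})"
      using Uder[OF l t] by (simp only: ge)
  qed (use start[OF l] in simp)
  \<comment> \<open>The bad parameters; the first part is a projection of a compact set.\<close>
  define N where "N = fst ` (({0..\<Lambda>} \<times> {0..1}) \<inter> (\<lambda>z. W (fst z) (snd z)) -` {..\<epsilon>})
      \<union> ({0..\<Lambda>} \<inter> (\<lambda>l. U l 1) -` {..0})"
  have N_iff: "l \<in> N \<longleftrightarrow> l \<in> {0..\<Lambda>} \<and> ((\<exists>t\<in>{0..1}. W l t \<le> \<epsilon>) \<or> U l 1 \<le> 0)" for l
  proof
    assume "l \<in> N"
    then show "l \<in> {0..\<Lambda>} \<and> ((\<exists>t\<in>{0..1}. W l t \<le> \<epsilon>) \<or> U l 1 \<le> 0)"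
      unfolding N_def by auto
  next
    assume R: "l \<in> {0..\<Lambda>} \<and> ((\<exists>t\<in>{0..1}. W l t \<le> \<epsilon>) \<or> U l 1 \<le> 0)"
    show "l \<in> N"
    proof (cases "U l 1 \<le> 0")
      case True
      then show ?thesis using R by (simp add: N_def)
    next
      case False
      then obtain t where "t \<in> {0..1}" "W l t \<le> \<epsilon>" using R by auto
      then have "fst (l, t) \<in> fst ` (({0..\<Lambda>} \<times> {0..1}) \<inter> (\<lambda>z. W (fst z) (snd z)) -` {..\<epsilon>})"
        using R by (intro imageI) simp
      then show ?thesis by (simp add: N_def)
    qed
  qed
  have "compact N"
  proof -
    have "closed (({0..\<Lambda>} \<times> {0..1}) \<inter> (\<lambda>z. W (fst z) (snd z)) -` {..\<epsilon>})"
      by (intro continuous_closed_preimage contW closed_Times) auto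
    then have "compact (({0..\<Lambda>} \<times> {0..1}) \<inter> (({0..\<Lambda>} \<times> {0..1}) \<inter> (\<lambda>z. W (fst z) (snd z)) -` {..\<epsilon>}))"
      by (intro compact_Int_closed compact_Times compact_Icc)
    then have "compact (({0..\<Lambda>} \<times> {0..1}) \<inter> (\<lambda>z. W (fst z) (snd z)) -` {..\<epsilon>})"
      by simp
    moreover have "compact ({0..\<Lambda>} \<inter> (\<lambda>l. U l 1) -` {..0})"
      by (intro compact_level_Icc contUt) auto
    ultimately show ?thesis
      unfolding N_def
      by (intro compact_Un compact_continuous_image continuous_on_fst continuous_on_id)
  qed
  moreover have "\<Lambda> \<in> N"
  proof (rule ccontr)
    assume "\<not> \<Lambda> \<in> N"
    then have big: "W \<Lambda> t > \<epsilon>" if "t \<in> {0..1}" for t using that \<Lambda> N_iff[of \<Lambda>] by (auto simp: not_le)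
    have "orbit \<Lambda> (W \<Lambda>) (U \<Lambda>)" using \<Lambda> less_imp_le[OF big] by (intro orb) auto
    from no[OF this] obtain t where "t \<in> {0..1}" "W \<Lambda> t \<le> 0" using start[of \<Lambda>] \<Lambda> \<epsilon> by auto
    then show False using big[of t] \<epsilon> by auto
  qed
  ultimately obtain lam where lamN: "lam \<in> N" and lam_le: "\<And>l. l \<in> N \<Longrightarrow> lam \<le> l"
    using compact_attains_inf[of N] by blast
  have lam: "lam \<in> {0..\<Lambda>}" using lamN by (simp add: N_iff)
  have "0 \<notin> N"
  proof -
    have z: "0 \<in> {0..\<Lambda>}" using \<Lambda> by simp
    have U: "U 0 t \<ge> a * \<epsilon> powr (1/m) * t" if "t \<in> {0..1}" for t
    proof -
      have "U 0 t - U 0 0 \<ge> a * \<epsilon> powr (1/m) * (t - 0)"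
      proof (rule growth_ge[where S = "{0..1}" and f = "U 0"])
        fix s assume "s \<in> {0<..<t}"
        have "\<epsilon> powr (1/m) \<le> max (W 0 s) \<epsilon> powr (1/m)" using \<epsilon> m1 by (intro powr_mono2) auto
        then show "a * \<epsilon> powr (1/m) \<le> a * max (W 0 s) \<epsilon> powr (1/m) - 0 * (1 - s) powr \<sigma> * max (W 0 s) \<epsilon> powr (p/m)"
          using a by simp
      qed (use that Uder[OF z] in auto)
      then show ?thesis using start[OF z] by simp
    qed
    have "W 0 t > \<epsilon>" if "t \<in> {0..1}" for t
    proof -
      have "W 0 t - W 0 0 \<ge> 0 * (t - 0)"
      proof (rule growth_ge[where S = "{0..1}" and f = "W 0"])
        fix s assume s: "s \<in> {0<..<t}"
        have "0 \<le> a * \<epsilon> powr (1/m) * s" using s a by simp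
        then have "0 \<le> U 0 s" using U[of s] s that by simp
        then show "0 \<le> B * (1 - s) * max (W 0 s) \<epsilon> powr (1/m) + U 0 s"
          using s that B by simp
      qed (use that Wder[OF z] in auto)
      then show ?thesis using start[OF z] \<epsilon> by simp
    qed
    moreover have "0 < a * \<epsilon> powr (1/m) * 1" using a \<epsilon> by simp
    then have "U 0 1 > 0" using U[of 1] by simp
    ultimately show ?thesis using N_iff[of 0] by (auto simp: not_le)
  qed
  then have lam0: "lam > 0" using lamN lam by (cases "lam = 0") auto
  have cl: "closure {0..<lam} = {0..lam}" using lam0 by simp
  have sub: "{0..lam} \<subseteq> {0..\<Lambda>}" using lam by simp
  have below: "W l t > \<epsilon>" "U l 1 > 0" if "l \<in> {0..<lam}" "t \<in> {0..1}" for l t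
  proof -
    have "l \<notin> N" "l \<in> {0..\<Lambda>}" using lam_le[of l] that lam by auto
    then show "W l t > \<epsilon>" "U l 1 > 0" using N_iff[of l] that(2) by (auto simp: not_le)
  qed
  have Wge: "W lam t \<ge> \<epsilon>" if t: "t \<in> {0..1}" for t
  proof (rule continuous_ge_on_closure[of "{0..<lam}" "\<lambda>l. W l t"])
    show "continuous_on (closure {0..<lam}) (\<lambda>l. W l t)"
      unfolding cl by (rule continuous_on_subset[OF contWt[OF t] sub])
    show "lam \<in> closure {0..<lam}" using lam0 cl by simp
  qed (use below(1)[OF _ t] in \<open>auto intro: less_imp_le\<close>)
  have Uge: "U lam 1 \<ge> 0"
  proof (rule continuous_ge_on_closure[of "{0..<lam}" "\<lambda>l. U l 1"])
    show "continuous_on (closure {0..<lam}) (\<lambda>l. U l 1)"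
      unfolding cl by (rule continuous_on_subset[OF contUt sub]) simp
    show "lam \<in> closure {0..<lam}" using lam0 cl by simp
  qed (use below(2)[of _ 1] in \<open>auto intro: less_imp_le\<close>)
  have flux: "flux (W lam) (U lam) t = B * (1 - t) * max (W lam t) \<epsilon> powr (1/m) + U lam t" if "t \<in> {0..1}" for t
    using Wge[OF that] by (simp add: flux_def max_absorb1)
  have "\<exists>t\<in>{0<..1}. flux (W lam) (U lam) t = 0 \<and> (t = 1 \<or> W lam t = \<epsilon>)"
  proof (cases "U lam 1 = 0")
    case True
    then show ?thesis by (intro bexI[of _ 1]) (auto simp: flux_def)
  next
    case False
    then have U1: "U lam 1 > 0" using Uge by simp
    then obtain t where t: "t \<in> {0..1}" "W lam t = \<epsilon>"
      using lamN N_iff[of lam] antisym[OF _ Wge] by auto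
    have D: "(W lam has_real_derivative flux (W lam) (U lam) t) (at t within {0..1})"
      using Wder[OF lam t(1)] flux[OF t(1)] by simp
    have "t \<noteq> 0" using t start[OF lam] \<epsilon> by auto
    moreover have "t \<noteq> 1"
    proof
      assume [simp]: "t = 1"
      have "flux (W lam) (U lam) 1 > 0" using U1 by (simp add: flux_def)
      then obtain d where d: "d > 0" "\<And>h. 0 < h \<Longrightarrow> 1 - h \<in> {0..1} \<Longrightarrow> h < d \<Longrightarrow> W lam (1 - h) < W lam 1"
        using has_real_derivative_pos_inc_left[OF D] by auto
      have "W lam (1 - min (d/2) 1) < W lam 1" using d(1) by (intro d(2)) auto
      then show False using Wge[of "1 - min (d/2) 1"] t d(1) by auto
    qed
    ultimately have t01: "0 < t" "t < 1" using t by auto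
    have "(W lam has_real_derivative flux (W lam) (U lam) t) (at t)"
      using D t01 by (simp add: at_within_Icc_at)
    then have "flux (W lam) (U lam) t = 0"
    proof (rule DERIV_local_min)
      show "0 < min t (1 - t)" using t01 by simp
      show "\<forall>y. \<bar>t - y\<bar> < min t (1 - t) \<longrightarrow> W lam t \<le> W lam y"
      proof (intro allI impI)
        fix y assume "\<bar>t - y\<bar> < min t (1 - t)"
        then have "y \<in> {0..1}" by (auto simp: abs_less_iff)
        then show "W lam t \<le> W lam y" using Wge t by simp
      qed
    qed
    then show ?thesis using t t01 by (intro bexI[of _ t]) auto
  qed
  then show ?thesis using that[OF lam orb[OF lam Wge] start(1)[OF lam]] by blast
qed

end

section \<open>The limit of vanishing height\<close>

lemma tendsto_uniform_limit_diagonal: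
  fixes f :: "nat \<Rightarrow> 'a::metric_space \<Rightarrow> 'b::metric_space"
  assumes ul: "uniform_limit S f g sequentially" and g: "continuous_on S g"
    and x: "\<And>n. x n \<in> S" "x \<longlonglongrightarrow> l" "l \<in> S"
  shows "(\<lambda>n. f n (x n)) \<longlonglongrightarrow> g l"
proof -
  have gx: "(\<lambda>n. g (x n)) \<longlonglongrightarrow> g l"
    using continuous_on_tendsto_compose[OF g x(2,3)] x(1) by auto
  show ?thesis
  proof (rule tendstoI)
    fix e :: real assume e: "e > 0"
    have "\<forall>\<^sub>F n in sequentially. dist (g (x n)) (g l) < e / 2"
      using gx e by (intro tendstoD) auto
    moreover have "\<forall>\<^sub>F n in sequentially. \<forall>s\<in>S. dist (f n s) (g s) < e / 2"
      using ul e by (intro uniform_limitD) auto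
    ultimately show "\<forall>\<^sub>F n in sequentially. dist (f n (x n)) (g l) < e"
    proof eventually_elim
      case (elim n)
      have "dist (f n (x n)) (g (x n)) < e / 2" using elim(2) x(1) by blast
      then show ?case using elim(1) dist_triangle[of "f n (x n)" "g l" "g (x n)"] by linarith
    qed
  qed
qed

context interface_system
begin

text \<open>
  The critical trajectories started from the heights \<open>2 \<epsilon> n\<close> subconverge, together with their parameters
  and with the times at which their flux vanishes. These times stay beyond \<open>\<tau>\<close> because the flux is
  positive up to there. The limiting parameter is not \<open>0\<close>: without reaction \<open>U\<close>, and with it the flux, would be
  positive once \<open>W\<close> is.
\<close>

lemma limit_orbit:
  obtains lam W U \<tau> t where "lam > 0" "orbit lam W U" "W 0 = 0" "0 < \<tau>" "\<tau> \<le> t" "t \<le> 1"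
    "\<And>s. s \<in> {0<..\<tau>} \<Longrightarrow> W s > 0" "flux W U t = 0" "t = 1 \<or> W t = 0"
proof -
  obtain \<Lambda> where \<Lambda>: "\<Lambda> > 0"
    and no: "\<And>W U. orbit \<Lambda> W U \<Longrightarrow> 0 < W 0 \<Longrightarrow> W 0 \<le> 1 \<Longrightarrow> \<exists>t\<in>{0..1}. W t \<le> 0"
    using no_positive_orbit by blast
  define \<epsilon> where "\<epsilon> n = inverse (real (Suc n)) / 2" for n
  have \<epsilon>: "\<epsilon> n > 0" "2 * \<epsilon> n \<le> 1" for n by (auto simp: \<epsilon>_def field_simps)
  have \<epsilon>0: "\<epsilon> \<longlonglongrightarrow> 0"
    using tendsto_divide[OF LIMSEQ_inverse_real_of_nat tendsto_const[of 2]] by (simp add: \<epsilon>_def[abs_def])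
  have "\<exists>lam W U t. lam \<in> {0..\<Lambda>} \<and> orbit lam W U \<and> W 0 = 2 * \<epsilon> n \<and>
      t \<in> {0<..1} \<and> flux W U t = 0 \<and> (t = 1 \<or> W t = \<epsilon> n)" for n
    by (rule shooting[OF \<epsilon>[of n] \<Lambda>]; use no in blast)
  then obtain lam W U t where lam: "\<And>n. lam n \<in> {0..\<Lambda>}" and orb: "\<And>n. orbit (lam n) (W n) (U n)"
    and W0: "\<And>n. W n 0 = 2 * \<epsilon> n" and t: "\<And>n. t n \<in> {0<..1}" and flux0: "\<And>n. flux (W n) (U n) (t n) = 0"
    and tend: "\<And>n. t n = 1 \<or> W n (t n) = \<epsilon> n"
    by metis
  have nonneg: "W n s \<ge> 0" if "s \<in> {0..1}" for n s using orb[of n] that by (simp add: orbit_def)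
  define S where "S = sup_bound"
  have S1: "S \<ge> 1" using sup_bound_ge_1 by (simp add: S_def)
  have lam0: "lam n \<ge> 0" "lam n \<le> \<Lambda>" for n using lam[of n] by auto
  have phi: "W n s powr (1/m) \<le> S" if "s \<in> {0..1}" for n s
    unfolding S_def by (rule orbit_bounded[OF orb lam0(1) _ that]) (use W0 \<epsilon> in auto)
  \<comment> \<open>The hypothesis of \<open>orbit_start\<close> for all \<open>lam \<le> \<Lambda>\<close> at once, the height bound being the one of \<open>orbit_bounded\<close>.\<close>
  define \<tau> where "\<tau> = min (1/4) (B / (4 * \<Lambda> * S powr (p - 1)))"
  have Sp: "S powr (p - 1) > 0" using S1 by simp
  have \<tau>: "0 < \<tau>" "\<tau> \<le> 1/4" "\<Lambda> * \<tau> * S powr (p - 1) \<le> B / 4"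
  proof -
    have D: "4 * \<Lambda> * S powr (p - 1) > 0" using \<Lambda> Sp by simp
    then show "0 < \<tau>" "\<tau> \<le> 1/4" using B by (auto simp: \<tau>_def)
    have "\<tau> \<le> B / (4 * \<Lambda> * S powr (p - 1))" by (simp add: \<tau>_def)
    then have "\<tau> * (4 * \<Lambda> * S powr (p - 1)) \<le> B" using D by (simp add: pos_le_divide_eq)
    then show "\<Lambda> * \<tau> * S powr (p - 1) \<le> B / 4" by (simp add: mult_ac)
  qed
  define b where "b = (1 - 1/m) * (B / 2)"
  have b: "b > 0" using m1 B by (simp add: b_def)
  have start: "flux (W n) (U n) s \<ge> B / 2 * W n s powr (1/m)" "W n s \<ge> W n 0" "W n s powr (1 - 1/m) \<ge> b * s"
    if s: "s \<in> {0..\<tau>}" for n s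
  proof -
    have "lam n * \<tau> * S powr (p - 1) \<le> \<Lambda> * \<tau> * S powr (p - 1)"
      using lam0 \<tau> Sp by (intro mult_right_mono) auto
    then have small: "lam n * \<tau> * S powr (p - 1) \<le> B / 4" using \<tau>(3) by linarith
    have le: "W n r powr (1/m) \<le> S" if "r \<in> {0..\<tau>}" for r using phi[of r n] that \<tau> by auto
    have "W n 0 > 0" "S \<ge> 0" using W0 \<epsilon> S1 by auto
    note * = orbit_start[OF orb lam0(1) this(1) \<tau>(2) this(2) small le s]
    show "flux (W n) (U n) s \<ge> B / 2 * W n s powr (1/m)" "W n s \<ge> W n 0" "W n s powr (1 - 1/m) \<ge> b * s"
      using * by (simp_all add: b_def)
  qed
  have t\<tau>: "t n > \<tau>" for n
  proof (rule ccontr)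
    assume "\<not> t n > \<tau>"
    then have s: "t n \<in> {0..\<tau>}" using t[of n] by auto
    have "W n (t n) > 0" using start(2)[OF s, of n] W0 \<epsilon>[of n] by simp
    then have "B / 2 * W n (t n) powr (1/m) > 0" using B by simp
    then show False using start(1)[OF s, of n] flux0[of n] by simp
  qed
  define C where "C = a * S + \<Lambda> * S powr p"
  have C0: "C \<ge> 0" using a \<Lambda> S1 by (simp add: C_def)
  have Ubound: "\<bar>U n s\<bar> \<le> C" if s: "s \<in> {0..1}" for n s
  proof -
    let ?f = "\<lambda>r. a * W n r powr (1/m) - lam n * (1 - r) powr \<sigma> * W n r powr (p/m)"
    have U0: "U n 0 = 0" and der: "(U n has_real_derivative ?f r) (at r within {0..1})" if "r \<in> {0..1}" for r
      using orb[of n] that by (auto simp: orbit_def)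
    have f: "\<bar>?f r\<bar> \<le> C" if "r \<in> {0..1}" for r
    proof -
      have "W n r powr (p/m) = (W n r powr (1/m)) powr p" by (simp add: powr_powr)
      also have "\<dots> \<le> S powr p" using phi[OF that] p1 by (intro powr_mono2) auto
      finally have "W n r powr (p/m) \<le> S powr p" .
      moreover have "(1 - r) powr \<sigma> \<le> 1" using that \<sigma> by (intro powr_le1) auto
      ultimately have "lam n * (1 - r) powr \<sigma> * W n r powr (p/m) \<le> \<Lambda> * 1 * S powr p"
        using lam0 \<Lambda> by (intro mult_mono) auto
      moreover have "0 \<le> lam n * (1 - r) powr \<sigma> * W n r powr (p/m)" using lam0 by simp
      moreover have "a * W n r powr (1/m) \<le> a * S" "0 \<le> a * W n r powr (1/m)"
        using a phi[OF that] by (auto intro: mult_left_mono)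
      moreover have "0 \<le> a * S" "0 \<le> \<Lambda> * S powr p" using a \<Lambda> S1 by auto
      ultimately show ?thesis unfolding C_def by linarith
    qed
    have "U n s - U n 0 \<le> C * (s - 0)"
    proof (rule growth_le[where S = "{0..1}" and f = "U n" and f' = ?f])
      show "?f r \<le> C" if "r \<in> {0<..<s}" for r using f[of r] that s by auto
    qed (use der s in auto)
    moreover have "U n s - U n 0 \<ge> - C * (s - 0)"
    proof (rule growth_ge[where S = "{0..1}" and f = "U n" and f' = ?f])
      show "- C \<le> ?f r" if "r \<in> {0<..<s}" for r using f[of r] that s by auto
    qed (use der s in auto)
    moreover have "C * s \<le> C" using C0 s by (simp add: mult_left_le)
    ultimately show ?thesis using U0[of 0] by (simp add: abs_le_iff)
  qed
  define K where "K = {0..S powr m} \<times> {- C..C}"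
  have Kc: "compact K" by (simp add: K_def compact_Times)
  have inK: "(W n s, U n s) \<in> K" if s: "s \<in> {0..1}" for n s
  proof -
    have "W n s = (W n s powr (1/m)) powr m" using nonneg[OF s] m1 by (simp add: powr_powr)
    also have "\<dots> \<le> S powr m" using phi[OF s] m1 by (intro powr_mono2) auto
    finally show ?thesis using nonneg[OF s, of n] Ubound[OF s, of n] by (simp add: K_def abs_le_iff)
  qed
  have contF: "continuous_on ({0..\<Lambda>} \<times> {0..1} \<times> K) (\<lambda>(l,t,x). field l t x)"
    by (rule continuous_on_subset[OF field_continuous[of "{0..\<Lambda>}"]]) (auto simp: K_def)
  have der: "((\<lambda>s. (W n s, U n s)) has_vector_derivative field (lam n) s (W n s, U n s)) (at s within {0..1})"
    if "s \<in> {0..1}" for n s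
    using orb[of n] that unfolding orbit_iff_field by blast
  obtain r l y where r: "strict_mono (r :: nat \<Rightarrow> nat)" and l: "l \<in> {0..\<Lambda>}"
    and ul: "uniform_limit {0..1} (\<lambda>n s. (W (r n) s, U (r n) s)) y sequentially"
    and yK: "\<And>s. s \<in> {0..1} \<Longrightarrow> y s \<in> K"
    and yder: "\<And>s. s \<in> {0..1} \<Longrightarrow> (y has_vector_derivative field l s (y s)) (at s within {0..1})"
  proof (rule ode_solutions_compact[OF compact_Icc Kc contF lam inK der])
    fix r :: "nat \<Rightarrow> nat" and l y
    assume 1: "strict_mono r" and 2: "l \<in> {0..\<Lambda>}"
      and 3: "uniform_limit {0..1} (\<lambda>n s. (W (r n) s, U (r n) s)) y sequentially"
      and 4: "\<And>s. s \<in> {0..1} \<Longrightarrow> y s \<in> K"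
      and 5: "\<And>s. s \<in> {0..1} \<Longrightarrow> (y has_vector_derivative field l s (y s)) (at s within {0..1})"
    show thesis by (rule that[OF 1 2 3 4 5])
  qed
  define w where "w s = fst (y s)" for s
  define u where "u s = snd (y s)" for s
  have y: "y = (\<lambda>s. (w s, u s))" by (simp add: w_def u_def)
  have conty: "continuous_on {0..1} y"
    unfolding continuous_on_eq_continuous_within
    using has_vector_derivative_continuous[OF yder] by blast
  have ptw: "(\<lambda>n. W (r n) s) \<longlonglongrightarrow> w s" "(\<lambda>n. U (r n) s) \<longlonglongrightarrow> u s" if "s \<in> {0..1}" for s
    using tendsto_fst[OF tendsto_uniform_limitI[OF ul that]] tendsto_snd[OF tendsto_uniform_limitI[OF ul that]]
    by (simp_all add: w_def u_def)
  have \<epsilon>r: "(\<lambda>n. \<epsilon> (r n)) \<longlonglongrightarrow> 0" using LIMSEQ_subseq_LIMSEQ[OF \<epsilon>0 r] by (simp add: o_def)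
  have w0: "w 0 = 0"
  proof -
    have "(\<lambda>n. W (r n) 0) \<longlonglongrightarrow> 2 * 0" unfolding W0 by (intro tendsto_mult tendsto_const \<epsilon>r)
    then show ?thesis using LIMSEQ_unique[OF ptw(1)[of 0]] by simp
  qed
  have u0: "u 0 = 0"
  proof -
    have "U (r n) 0 = 0" for n using orb[of "r n"] by (simp add: orbit_def)
    then show ?thesis using LIMSEQ_unique[OF ptw(2)[of 0], of 0] by simp
  qed
  have wnn: "w s \<ge> 0" if "s \<in> {0..1}" for s using yK[OF that] by (auto simp: K_def y)
  have worb: "orbit l w u"
    unfolding orbit_iff_field using u0 wnn yder by (simp add: y)
  have wpos: "w s > 0" if s: "s \<in> {0<..\<tau>}" for s
  proof -
    have s1: "s \<in> {0..1}" using s \<tau> by auto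
    have "(\<lambda>n. W (r n) s powr (1 - 1/m)) \<longlonglongrightarrow> w s powr (1 - 1/m)"
      using ptw(1)[OF s1] nonneg[OF s1] m1 by (intro tendsto_powr2 tendsto_const) auto
    moreover have "b * s \<le> W (r n) s powr (1 - 1/m)" for n using start(3)[of s "r n"] s by simp
    ultimately have "b * s \<le> w s powr (1 - 1/m)" by (intro LIMSEQ_le_const) auto
    moreover have "b * s > 0" using b s by simp
    ultimately have "w s powr (1 - 1/m) > 0" by linarith
    then show ?thesis using wnn[OF s1] by (cases "w s = 0") auto
  qed
  have "compact {0..1::real}" by simp
  moreover have "\<forall>n. t (r n) \<in> {0..1}" using t by (auto intro: less_imp_le)
  ultimately obtain T q where T: "T \<in> {0..1}" and q: "strict_mono (q :: nat \<Rightarrow> nat)" and tq: "((\<lambda>n. t (r n)) \<circ> q) \<longlonglongrightarrow> T"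
    unfolding compact_def by meson
  have tlim: "(\<lambda>n. t (r (q n))) \<longlonglongrightarrow> T" using tq by (simp add: o_def)
  have T\<tau>: "\<tau> \<le> T" using t\<tau> by (intro LIMSEQ_le_const[OF tlim]) (auto intro: less_imp_le)
  have tin: "t (r (q n)) \<in> {0..1}" for n using t[of "r (q n)"] by auto
  have ulq: "uniform_limit {0..1} (\<lambda>n s. (W (r (q n)) s, U (r (q n)) s)) y sequentially"
    using filterlim_compose[OF ul filterlim_subseq[OF q]] by (simp add: o_def)
  have "(\<lambda>n. (W (r (q n)) (t (r (q n))), U (r (q n)) (t (r (q n))))) \<longlonglongrightarrow> y T"
    by (rule tendsto_uniform_limit_diagonal[OF ulq conty tin tlim T])
  from tendsto_fst[OF this] tendsto_snd[OF this]
  have Wq: "(\<lambda>n. W (r (q n)) (t (r (q n)))) \<longlonglongrightarrow> w T" and Uq: "(\<lambda>n. U (r (q n)) (t (r (q n)))) \<longlonglongrightarrow> u T"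
    by (simp_all add: w_def u_def)
  have fluxT: "flux w u T = 0"
  proof -
    have "(\<lambda>n. W (r (q n)) (t (r (q n))) powr (1/m)) \<longlonglongrightarrow> w T powr (1/m)"
      using Wq nonneg[OF tin] m1 by (intro tendsto_powr2 tendsto_const) auto
    then have "(\<lambda>n. flux (W (r (q n))) (U (r (q n))) (t (r (q n)))) \<longlonglongrightarrow> flux w u T"
      unfolding flux_def by (intro tendsto_add tendsto_mult tendsto_diff tendsto_const tlim Uq)
    then show ?thesis using LIMSEQ_unique[of "\<lambda>_. 0" "flux w u T" 0] by (simp add: flux0)
  qed
  have Tend: "T = 1 \<or> w T = 0"
  proof (rule disjCI)
    assume "w T \<noteq> 0"
    show "T = 1"
    proof (rule ccontr)
      assume "T \<noteq> 1"
      then have "T < 1" using T by simp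
      then have "\<forall>\<^sub>F n in sequentially. t (r (q n)) < 1" using order_tendstoD(2)[OF tlim] by blast
      then have "\<forall>\<^sub>F n in sequentially. W (r (q n)) (t (r (q n))) = \<epsilon> (r (q n))"
      proof eventually_elim
        case (elim n)
        then show ?case using tend[of "r (q n)"] by simp
      qed
      moreover have "(\<lambda>n. \<epsilon> (r (q n))) \<longlonglongrightarrow> 0"
        using LIMSEQ_subseq_LIMSEQ[OF \<epsilon>r q] by (simp add: o_def)
      ultimately have "(\<lambda>n. W (r (q n)) (t (r (q n)))) \<longlonglongrightarrow> 0"
        using tendsto_cong[of "\<lambda>n. W (r (q n)) (t (r (q n)))" "\<lambda>n. \<epsilon> (r (q n))"] by blast
      then show False using LIMSEQ_unique[OF Wq] \<open>w T \<noteq> 0\<close> by blast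
    qed
  qed
  have "l > 0"
  proof (rule ccontr)
    assume "\<not> l > 0"
    then have l0: "l = 0" using l by simp
    have uder: "(u has_real_derivative a * w s powr (1/m)) (at s within {0..1})" if "s \<in> {0..1}" for s
      using worb that by (simp add: orbit_def l0)
    obtain \<xi> where \<xi>: "0 < \<xi>" "\<xi> < \<tau>" "u \<tau> - u 0 = a * w \<xi> powr (1/m) * (\<tau> - 0)"
      using mvt_within[of 0 \<tau> "{0..1}" u "\<lambda>s. a * w s powr (1/m)"] \<tau> uder by auto
    have "w \<xi> > 0" using wpos[of \<xi>] \<xi> by simp
    then have "u \<tau> > 0" using \<xi>(3) u0 a \<tau> by simp
    moreover have "u T - u \<tau> \<ge> 0 * (T - \<tau>)"
      using T T\<tau> \<tau> a uder
      by (intro growth_ge[where S = "{0..1}" and f = u and f' = "\<lambda>s. a * w s powr (1/m)"]) auto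
    moreover have "B * (1 - T) * w T powr (1/m) \<ge> 0" using T B by simp
    ultimately show False using fluxT by (simp add: flux_def)
  qed
  then show ?thesis using that[of l w u \<tau> T] worb w0 \<tau>(1) T\<tau> T wpos fluxT Tend by simp
qed

end

section \<open>The profile\<close>

lemma DERIV_transform_on:
  assumes "(f has_field_derivative D) (at x within S)" "x \<in> S" "\<And>y. y \<in> S \<Longrightarrow> g y = f y"
  shows "(g has_field_derivative D) (at x within S)"
  unfolding has_field_derivative_def
  by (rule has_derivative_transform[where f = f and g = g and s = S, OF assms(2,3)
        assms(1)[unfolded has_field_derivative_def]])

lemma DERIV_cutoff:
  fixes f :: "real \<Rightarrow> real"
  assumes der: "\<And>x. x \<in> S \<Longrightarrow> x \<le> T \<Longrightarrow> (f has_real_derivative f' x) (at x within S \<inter> {..T})"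
    and T: "f T = 0" "f' T = 0" and x: "x \<in> S"
  shows "((\<lambda>x. if x \<le> T then f x else 0) has_real_derivative (if x \<le> T then f' x else 0)) (at x within S)"
proof -
  let ?g = "\<lambda>x. if x \<le> T then f x else 0"
  have left: "(?g has_real_derivative f' x) (at x within S \<inter> {..T})" if "x \<le> T"
    by (rule DERIV_transform_on[OF der[OF x that]]) (use x that in auto)
  have right: "(?g has_real_derivative 0) (at x within S \<inter> {T..})" if "T \<le> x"
    by (rule DERIV_transform_on[OF DERIV_const]) (use x that T in auto)
  consider "x < T" | "x = T" | "T < x" by linarith
  then show ?thesis
  proof cases
    case 1
    have "at x within S = at x within S \<inter> {..T}"
      by (rule at_within_nhd[of _ "{..<T}"]) (use 1 in auto)
    then show ?thesis using left 1 by simp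
  next
    case 2
    have "(S \<inter> {..T}) \<union> (S \<inter> {T..}) = S" by auto
    then have "at x within S = sup (at x within S \<inter> {..T}) (at x within S \<inter> {T..})"
      using at_within_union[of x "S \<inter> {..T}" "S \<inter> {T..}"] by (simp only:)
    moreover have "((\<lambda>y. (?g y - ?g x) / (y - x)) \<longlongrightarrow> 0) (at x within S \<inter> {..T})"
      "((\<lambda>y. (?g y - ?g x) / (y - x)) \<longlongrightarrow> 0) (at x within S \<inter> {T..})"
      using left right 2 T unfolding has_field_derivative_iff by simp_all
    ultimately have "((\<lambda>y. (?g y - ?g x) / (y - x)) \<longlongrightarrow> 0) (at x within S)"
      by (simp only: filterlim_sup)
    then show ?thesis using 2 T unfolding has_field_derivative_iff by simp
  next
    case 3
    have "at x within S = at x within S \<inter> {T..}"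
      by (rule at_within_nhd[of _ "{T<..}"]) (use 3 in auto)
    then show ?thesis using right 3 by simp
  qed
qed

context interface_system
begin

text \<open>
  Cutting the limit trajectory off after the zero of its flux. If this happens before time \<open>1\<close>, then \<open>W\<close> and
  its slope both vanish there and the continuation by zero is continuously differentiable; in either case
  the slope is zero at \<open>t = 1\<close>, which is the origin \<open>\<xi> = 0\<close>.
\<close>

lemma unit_profile:
  obtains lam W V \<tau> where "lam > 0" "0 < \<tau>" "\<tau> \<le> 1" "W 0 = 0" "V 0 = 0" "V 1 = 0"
    "continuous_on {0..1} V" "\<And>t. t \<in> {0..1} \<Longrightarrow> 0 \<le> W t"
    "\<And>t. t \<in> {0..1} \<Longrightarrow> (W has_real_derivative V t) (at t within {0..1})"
    "\<And>t. t \<in> {0<..\<tau>} \<Longrightarrow> W t > 0"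
    "\<And>t. t \<in> {0<..<1} \<Longrightarrow> W t > 0 \<Longrightarrow> (V has_real_derivative
        B * (1 - t) * (1/m * W t powr (1/m - 1) * V t) + (a - B) * W t powr (1/m)
        - lam * (1 - t) powr \<sigma> * W t powr (p/m)) (at t)"
proof -
  obtain lam W U \<tau> T where lam: "lam > 0" and orb: "orbit lam W U" and W0: "W 0 = 0"
    and \<tau>: "0 < \<tau>" "\<tau> \<le> T" "T \<le> 1" and pos: "\<And>s. s \<in> {0<..\<tau>} \<Longrightarrow> W s > 0"
    and fT: "flux W U T = 0" and T: "T = 1 \<or> W T = 0"
    using limit_orbit by blast
  define w where "w t = (if t \<le> T then W t else 0)" for t
  define v where "v t = (if t \<le> T then flux W U t else 0)" for t
  note O = orb[unfolded orbit_def]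
  have wder: "(w has_real_derivative v t) (at t within {0..1})" if t: "t \<in> {0..1}" for t
  proof (cases "T = 1")
    case True
    have "(W has_real_derivative flux W U t) (at t within {0..1})" using O t by blast
    then have "(w has_real_derivative flux W U t) (at t within {0..1})"
      by (rule DERIV_transform_on[OF _ t]) (use True in \<open>auto simp: w_def\<close>)
    then show ?thesis using t True by (simp add: v_def)
  next
    case False
    then have WT: "W T = 0" using T by simp
    show ?thesis
      unfolding w_def[abs_def] v_def
    proof (rule DERIV_cutoff[where f = W and f' = "flux W U", OF _ _ fT t])
      show "(W has_real_derivative flux W U s) (at s within {0..1} \<inter> {..T})" if "s \<in> {0..1}" for s
        by (rule has_field_derivative_subset[of _ _ _ "{0..1}"]) (use O that in auto)
    qed (rule WT)
  qed
  have "continuous_on ({0..T} \<union> {T..1}) v"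
    unfolding v_def[abs_def]
  proof (rule continuous_on_If)
    show "continuous_on {0..T} (flux W U)"
      using orbit_continuous(3)[OF orb] by (rule continuous_on_subset) (use \<tau> in auto)
  qed (use fT in auto)
  moreover have "{0..T} \<union> {T..1} = {0..1}" using \<tau> by auto
  ultimately have contv: "continuous_on {0..1} v" by simp
  have second: "(v has_real_derivative
        B * (1 - t) * (1/m * w t powr (1/m - 1) * v t) + (a - B) * w t powr (1/m)
        - lam * (1 - t) powr \<sigma> * w t powr (p/m)) (at t)" if t: "t \<in> {0<..<1}" and wt: "w t > 0" for t
  proof -
    have tT: "t < T" using wt T t by (cases "t = T") (auto simp: w_def split: if_splits)
    have wW: "w t = W t" "v t = flux W U t" using tT by (auto simp: w_def v_def)
    have at: "at t within {0..1} = at t" using t by (intro at_within_Icc_at) auto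
    have Wd: "(W has_real_derivative flux W U t) (at t)"
      and Ud: "(U has_real_derivative a * W t powr (1/m) - lam * (1 - t) powr \<sigma> * W t powr (p/m)) (at t)"
      using O t by (auto simp: at[symmetric])
    have phid: "((\<lambda>t. W t powr (1/m)) has_real_derivative 1/m * W t powr (1/m - 1) * flux W U t) (at t)"
      by (rule DERIV_chain2[where f = "\<lambda>z. z powr (1/m)" and g = W, OF has_real_derivative_powr Wd])
         (use wt wW in simp)
    have lin: "((\<lambda>t. B * (1 - t)) has_real_derivative - B) (at t)"
      by (auto intro!: derivative_eq_intros)
    have "(flux W U has_real_derivative
        - B * W t powr (1/m) + 1/m * W t powr (1/m - 1) * flux W U t * (B * (1 - t))
        + (a * W t powr (1/m) - lam * (1 - t) powr \<sigma> * W t powr (p/m))) (at t)"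
      unfolding flux_def[abs_def]
      by (rule DERIV_add[OF DERIV_mult[OF lin phid[unfolded flux_def]] Ud])
    then have "(v has_real_derivative
        - B * W t powr (1/m) + 1/m * W t powr (1/m - 1) * flux W U t * (B * (1 - t))
        + (a * W t powr (1/m) - lam * (1 - t) powr \<sigma> * W t powr (p/m))) (at t)"
      by (rule has_field_derivative_transform_within_open[of _ _ _ "{..<T}"]) (use tT in \<open>auto simp: v_def\<close>)
    then show ?thesis
      unfolding wW by (rule DERIV_cong) (simp add: algebra_simps)
  qed
  show ?thesis
  proof (rule that[of lam \<tau> w v])
    show "w 0 = 0" "v 0 = 0" using W0 O \<tau> by (auto simp: w_def v_def flux_def)
    show "v 1 = 0" using fT \<tau> by (auto simp: v_def)
    show "0 \<le> w t" if "t \<in> {0..1}" for t using O that by (auto simp: w_def)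
    show "w t > 0" if "t \<in> {0<..\<tau>}" for t using pos that \<tau> by (auto simp: w_def)
    show "\<tau> \<le> 1" using \<tau> by simp
  qed (rule lam \<tau>(1) contv wder second; assumption)+
qed

end

text \<open>
  Undoing the scaling by \<open>f \<xi> = k W(1 - \<xi> / \<eta>)\<^bsup>1/m\<^esup>\<close>, continued by zero beyond \<open>\<eta>\<close>. The slope of \<open>f\<^sup>m\<close> at the
  origin is zero. If \<open>f 0 > 0\<close>, the root is differentiable at \<open>f\<^sup>m\<close> there and (P1) holds; otherwise this is (P2).
\<close>

theorem theorem1p2:
  fixes m p \<sigma> :: real
  assumes "1 < p" and "p < m" and "\<sigma> > 0"
  shows "\<exists>f \<eta>. good_profile_interface_at m p \<sigma> f \<eta>"
proof -
  define \<alpha> where "\<alpha> = profile_alpha m p \<sigma>"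
  define \<beta> where "\<beta> = profile_beta m p \<sigma>"
  have m1: "m > 1" using assms by simp
  have D: "2 * (p - 1) + \<sigma> * (m - 1) > 0" using assms by (intro add_pos_pos) auto
  have ab: "\<alpha> > 0" "\<beta> > 0"
  proof -
    show "\<alpha> > 0"
      unfolding \<alpha>_def profile_alpha_def by (rule divide_pos_pos[OF _ D]) (use assms in linarith)
    show "\<beta> > 0"
      unfolding \<beta>_def profile_beta_def by (rule divide_pos_pos[OF _ D]) (use assms in linarith)
  qed
  interpret interface_system m p \<sigma> "\<alpha> + \<beta>" \<beta>
    by (rule interface_system.intro[OF assms add_pos_pos[OF ab] ab(2)])
  obtain lam W V \<tau> where lam: "lam > 0" and \<tau>: "0 < \<tau>" "\<tau> \<le> 1" and W0: "W 0 = 0" and V0: "V 0 = 0"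
    and V1: "V 1 = 0" and contV: "continuous_on {0..1} V" and Wnn: "\<And>t. t \<in> {0..1} \<Longrightarrow> 0 \<le> W t"
    and Wder: "\<And>t. t \<in> {0..1} \<Longrightarrow> (W has_real_derivative V t) (at t within {0..1})"
    and Wpos: "\<And>t. t \<in> {0<..\<tau>} \<Longrightarrow> W t > 0"
    and Vder: "\<And>t. t \<in> {0<..<1} \<Longrightarrow> W t > 0 \<Longrightarrow> (V has_real_derivative
        \<beta> * (1 - t) * (1/m * W t powr (1/m - 1) * V t) + (\<alpha> + \<beta> - \<beta>) * W t powr (1/m)
        - lam * (1 - t) powr \<sigma> * W t powr (p/m)) (at t)"
  proof (rule unit_profile)
  qed (rule that)

  \<comment> \<open>The scaling of the profile is determined by \<open>k\<^bsup>m-1\<^esup> = \<eta>\<^sup>2\<close> and \<open>lam = \<eta>\<^sup>\<sigma> k\<^bsup>p-1\<^esup>\<close>.\<close>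
  define \<eta> where "\<eta> = lam powr (1 / (\<sigma> + 2 * (p - 1) / (m - 1)))"
  define k where "k = \<eta> powr (2 / (m - 1))"
  have \<eta>: "\<eta> > 0" using lam by (simp add: \<eta>_def)
  have k: "k > 0" using \<eta> by (simp add: k_def)
  have km: "k powr m = k * \<eta>^2"
  proof -
    have "2 / (m - 1) * (m - 1) = 2" using m1 by (simp add: field_simps)
    then have "k powr (m - 1) = \<eta> powr 2" by (simp only: k_def powr_powr)
    then have "k powr (m - 1) = \<eta>^2" using \<eta> by simp
    then show ?thesis using powr_mult_base[of k "m - 1"] k by simp
  qed
  have klam: "k * lam = \<eta> powr \<sigma> * k powr p"
  proof -
    have e: "\<sigma> + 2 * (p - 1) / (m - 1) > 0" using assms by (intro add_pos_nonneg) auto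
    have "\<eta> powr \<sigma> * k powr (p - 1) = \<eta> powr (\<sigma> + 2 * (p - 1) / (m - 1))"
      unfolding k_def powr_powr powr_add by (simp add: mult.commute)
    also have "\<dots> = lam" using e lam by (simp add: \<eta>_def powr_powr)
    finally have "k * lam = \<eta> powr \<sigma> * (k * k powr (p - 1))" by simp
    then show ?thesis using powr_mult_base[of k "p - 1"] k by simp
  qed

  define f where "f x = k * (if x \<le> \<eta> then W (1 - x / \<eta>) else 0) powr (1/m)" for x
  \<comment> \<open>\<open>G\<close> is \<open>f\<^sup>m\<close> on the half-line, written without the roots that are singular at its zeros.\<close>
  define G where "G x = (if x \<le> \<eta> then k powr m * W (1 - x / \<eta>) else 0)" for x
  define G' where "G' x = (if x \<le> \<eta> then - (k powr m / \<eta>) * V (1 - x / \<eta>) else 0)" for x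
  have unit: "1 - x / \<eta> \<in> {0..1}" if "0 \<le> x" "x \<le> \<eta>" for x
    using that \<eta> divide_le_eq_1_pos[OF \<eta>, of x] divide_nonneg_pos[OF that(1) \<eta>] by simp
  have arg: "((\<lambda>x. 1 - x / \<eta>) has_real_derivative - (1 / \<eta>)) (at x within S)" for x S
    using \<eta> by (auto intro!: derivative_eq_intros)
  have fG: "f x powr m = G x" "G x \<ge> 0" if x: "x \<ge> 0" for x
  proof -
    have "W (1 - x / \<eta>) \<ge> 0" if "x \<le> \<eta>" using Wnn[OF unit[OF x that]] .
    then show "f x powr m = G x" "G x \<ge> 0" using k m1 by (auto simp: f_def G_def powr_mult powr_powr)
  qed
  have Gder: "(G has_real_derivative G' x) (at x within {0..})" if x: "x \<in> {0..}" for x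
    unfolding G_def[abs_def] G'_def
  proof (rule DERIV_cutoff[OF _ _ _ x])
    fix x assume x: "x \<in> {0..}" "x \<le> \<eta>"
    have "(W has_real_derivative V (1 - x / \<eta>)) (at (1 - x / \<eta>) within (\<lambda>x. 1 - x / \<eta>) ` ({0..} \<inter> {..\<eta>}))"
      by (rule has_field_derivative_subset[OF Wder]) (use unit x in auto)
    from DERIV_image_chain[OF this arg]
    have "((\<lambda>x. W (1 - x / \<eta>)) has_real_derivative V (1 - x / \<eta>) * - (1 / \<eta>)) (at x within {0..} \<inter> {..\<eta>})"
      by (simp add: o_def)
    from DERIV_cmult[OF this, of "k powr m"]
    show "((\<lambda>x. k powr m * W (1 - x / \<eta>)) has_real_derivative - (k powr m / \<eta>) * V (1 - x / \<eta>))
        (at x within {0..} \<inter> {..\<eta>})"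
      by (rule DERIV_cong) simp
  qed (use W0 V0 \<eta> in auto)
  have contG': "continuous_on {0..} G'"
  proof -
    have "continuous_on ({0..\<eta>} \<union> {\<eta>..}) G'"
      unfolding G'_def[abs_def]
    proof (rule continuous_on_If)
      have "continuous_on {0..\<eta>} (\<lambda>x. V (1 - x / \<eta>))"
        by (rule continuous_on_compose2[OF contV]) (use unit \<eta> in \<open>auto intro!: continuous_intros\<close>)
      then show "continuous_on {0..\<eta>} (\<lambda>x. - (k powr m / \<eta>) * V (1 - x / \<eta>))"
        by (rule continuous_on_mult_left)
    qed (use V0 \<eta> in auto)
    moreover have "{0..\<eta>} \<union> {\<eta>..} = {0..}" using \<eta> by auto
    ultimately show ?thesis by simp
  qed
  have Fder: "((\<lambda>x. f x powr m) has_real_derivative G' x) (at x within {0..})" if "x \<in> {0..}" for x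
    by (rule DERIV_transform_on[OF Gder[OF that] that]) (use fG in auto)
  have Fder': "((\<lambda>x. f x powr m) has_real_derivative G' x) (at x)" if "x > 0" for x
  proof -
    have "at x within {0..} = at x within UNIV"
      by (rule at_within_nhd[of _ "{0<..}"]) (use that in auto)
    then show ?thesis using Fder[of x] that by simp
  qed
  have fpowr: "f x = (G x) powr (1/m)" if "x \<ge> 0" for x
    using fG[OF that] m1 k by (auto simp: f_def simp flip: fG(1)[OF that] simp: powr_powr)
  have contf: "continuous_on {0..} f"
  proof (rule continuous_on_eq)
    have "continuous_on {0..} G"
      using Gder DERIV_continuous by (metis continuous_on_eq_continuous_within)
    then show "continuous_on {0..} (\<lambda>x. G x powr (1/m))"
      using fG(2) m1 by (intro continuous_on_powr' continuous_on_const) auto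
  qed (use fpowr in auto)

  have equation: "f differentiable (at \<xi>) \<and> deriv (\<lambda>x. f x powr m) differentiable (at \<xi>) \<and>
      deriv (deriv (\<lambda>x. f x powr m)) \<xi> - \<alpha> * f \<xi> + \<beta> * \<xi> * deriv f \<xi> + \<xi> powr \<sigma> * f \<xi> powr p = 0"
    if \<xi>: "\<xi> > 0" and fpos: "f \<xi> > 0" for \<xi>
  proof -
    define t where "t = 1 - \<xi> / \<eta>"
    have "\<xi> < \<eta>"
    proof (rule ccontr)
      assume "\<not> \<xi> < \<eta>"
      then have "f \<xi> = 0" using W0 \<eta> m1 by (auto simp: f_def)
      then show False using fpos by simp
    qed
    then have t: "t \<in> {0<..<1}" "0 \<le> \<xi>" "\<xi> \<le> \<eta>" using \<xi> \<eta> by (auto simp: t_def)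
    have f\<xi>: "f \<xi> = k * W t powr (1/m)" using t by (simp add: f_def t_def)
    have Wt: "W t > 0"
      using Wnn[of t] fpos t f\<xi> by (cases "W t = 0") auto
    have at: "at t within {0..1} = at t" using t by (intro at_within_Icc_at) auto
    have dW: "((\<lambda>x. W (1 - x / \<eta>)) has_real_derivative V t * - (1 / \<eta>)) (at \<xi>)"
      by (rule DERIV_chain2[where f = W, OF _ arg]) (use Wder[of t] at t in \<open>auto simp: t_def\<close>)
    have dV: "((\<lambda>x. V (1 - x / \<eta>)) has_real_derivative
        (\<beta> * (1 - t) * (1/m * W t powr (1/m - 1) * V t) + (\<alpha> + \<beta> - \<beta>) * W t powr (1/m)
        - lam * (1 - t) powr \<sigma> * W t powr (p/m)) * - (1 / \<eta>)) (at \<xi>)"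
      by (rule DERIV_chain2[where f = V, OF _ arg]) (use Vder[OF t(1) Wt] in \<open>auto simp: t_def\<close>)
    define D where "D = k * (1/m * W t powr (1/m - 1) * (V t * - (1 / \<eta>)))"
    have "((\<lambda>x. W (1 - x / \<eta>) powr (1/m)) has_real_derivative 1/m * W t powr (1/m - 1) * (V t * - (1 / \<eta>))) (at \<xi>)"
      by (rule DERIV_chain2[where f = "\<lambda>z. z powr (1/m)", OF _ dW])
         (use has_real_derivative_powr[OF Wt, of "1/m"] in \<open>simp only: t_def\<close>)
    from DERIV_cmult[OF this, of k]
    have df: "(f has_real_derivative D) (at \<xi>)"
      unfolding D_def
      by (rule has_field_derivative_transform_within_open[of _ _ _ "{..<\<eta>}"])
         (use \<open>\<xi> < \<eta>\<close> in \<open>auto simp: f_def\<close>)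
    define E where "E = k * (\<beta> * (1 - t) * (1/m * W t powr (1/m - 1) * V t) + \<alpha> * W t powr (1/m)
        - lam * (1 - t) powr \<sigma> * W t powr (p/m))"
    have "((\<lambda>x. - (k powr m / \<eta>) * V (1 - x / \<eta>)) has_real_derivative E) (at \<xi>)"
      using DERIV_cmult[OF dV, of "- (k powr m / \<eta>)"]
      by (rule DERIV_cong) (use \<eta> in \<open>simp add: E_def km power2_eq_square\<close>)
    then have ddF: "(deriv (\<lambda>x. f x powr m) has_real_derivative E) (at \<xi>)"
    proof (rule has_field_derivative_transform_within_open[of _ _ _ "{0<..<\<eta>}"])
      fix x assume x: "x \<in> {0<..<\<eta>}"
      then show "- (k powr m / \<eta>) * V (1 - x / \<eta>) = deriv (\<lambda>x. f x powr m) x"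
        using DERIV_imp_deriv[OF Fder'[of x]] by (simp add: G'_def)
    qed (use \<xi> \<open>\<xi> < \<eta>\<close> in auto)
    have x1: "1 - t = \<xi> / \<eta>" by (simp add: t_def)
    have reaction: "k * lam * (1 - t) powr \<sigma> * W t powr (p/m) = \<xi> powr \<sigma> * f \<xi> powr p"
    proof -
      have "\<eta> powr \<sigma> * (1 - t) powr \<sigma> = \<xi> powr \<sigma>"
        using \<eta> \<xi> by (simp add: x1 flip: powr_mult)
      moreover have "f \<xi> powr p = k powr p * W t powr (p/m)"
        using k Wt by (simp add: f\<xi> powr_mult powr_powr)
      ultimately show ?thesis unfolding klam by simp
    qed
    have drift: "\<beta> * \<xi> * D = - (k * (\<beta> * (1 - t) * (1/m * W t powr (1/m - 1) * V t)))"
      by (simp add: D_def x1 mult_ac)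
    have growth: "\<alpha> * f \<xi> = k * (\<alpha> * W t powr (1/m))" by (simp add: f\<xi>)
    have "E = k * (\<beta> * (1 - t) * (1/m * W t powr (1/m - 1) * V t)) + k * (\<alpha> * W t powr (1/m))
        - k * lam * (1 - t) powr \<sigma> * W t powr (p/m)"
      by (simp only: E_def right_diff_distrib distrib_left mult.assoc)
    then have "E - \<alpha> * f \<xi> + \<beta> * \<xi> * D + \<xi> powr \<sigma> * f \<xi> powr p = 0"
      unfolding reaction drift growth by linarith
    then show ?thesis
      using df ddF by (auto simp: DERIV_imp_deriv real_differentiable_def)
  qed

  have sol: "profile_solution m p \<sigma> f"
    unfolding profile_solution_def C1_halfline_def
    using contf contG' Fder equation k by (auto simp: \<alpha>_def \<beta>_def f_def)
  have F0: "((\<lambda>x. f x powr m) has_real_derivative 0) (at 0 within {0..})"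
    using Fder[of 0] V1 \<eta> by (simp add: G'_def)
  have good: "good_profile m p \<sigma> f"
  proof (cases "f 0 = 0")
    case True
    then show ?thesis using sol F0 by (simp add: good_profile_def)
  next
    case False
    then have f0: "f 0 > 0" using k by (simp add: f_def less_le)
    then have G0: "G 0 > 0" using fG[of 0] by (metis order_refl powr_gt_zero less_irrefl)
    have "((\<lambda>x. G x powr (1/m)) has_real_derivative 1/m * G 0 powr (1/m - 1) * G' 0) (at 0 within {0..})"
      by (rule DERIV_chain2[where f = "\<lambda>z. z powr (1/m)", OF has_real_derivative_powr[OF G0] Gder]) simp
    then have "(f has_real_derivative 1/m * G 0 powr (1/m - 1) * G' 0) (at 0 within {0..})"
      by (rule DERIV_transform_on) (use fpowr in auto)
    then have "(f has_real_derivative 0) (at 0 within {0..})" using V1 \<eta> by (simp add: G'_def)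
    then show ?thesis using sol f0 by (simp add: good_profile_def)
  qed
  have "good_profile_interface_at m p \<sigma> f \<eta>"
    unfolding good_profile_interface_at_def
  proof (intro conjI good \<eta>)
    show "f \<eta> = 0" using W0 \<eta> m1 by (simp add: f_def)
    show "((\<lambda>x. f x powr m) has_real_derivative 0) (at \<eta>)"
      using Fder'[OF \<eta>] V0 \<eta> by (simp add: G'_def)
    show "\<exists>\<delta>>0. \<delta> \<le> \<eta> \<and> (\<forall>x\<in>{\<eta> - \<delta><..<\<eta>}. f x > 0)"
    proof (intro exI[of _ "\<tau> * \<eta>"] conjI ballI)
      show "0 < \<tau> * \<eta>" "\<tau> * \<eta> \<le> \<eta>" using \<tau> \<eta> by auto
      fix x assume x: "x \<in> {\<eta> - \<tau> * \<eta><..<\<eta>}"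
      then have "1 - x / \<eta> \<in> {0<..\<tau>}" using \<eta> by (auto simp: field_simps)
      then have "W (1 - x / \<eta>) > 0" by (rule Wpos)
      then show "f x > 0" using x k by (simp add: f_def)
    qed
  qed
  then show ?thesis by blast
qed

end
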